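(* For every $\varepsilon>0$ there exists a sequence of unsatisfiable hitting formulas $G_m$, each containing $2^{\tilde O(m)}$ clauses of width $\tilde O(m)$, such that every tree-like Res$(\oplus)$ refutation of $G_m$ has size $2^{\tilde\Omega(m^{2-\varepsilon})}$.
   Context: A hitting formula is a CNF in which every two distinct clauses contain complementary literals. The width of a clause is its number of literals. Res$(\oplus)$ is the proof system whose lines are linear clauses, i.e., disjunctions of affine equations over $\mathrm{GF}(2)$ of the form $\bigoplus_{i\in I}x_i=c$ (a literal $x$ is the equation $x=1$, $\bar x$ is $x=0$; an assignment falsifies a linear clause iff it falsifies all its equations). Its rules are the resolution rule: from $C\vee(f=0)$ and $D\vee(f=1)$ derive $C\vee D$ (where $f$ is a linear form), and the weakening rule: from $C$ derive any linear clause $D$ semantically implied by $C$. A refutation of a CNF $F$ derives the empty clause from the clauses of $F$. A tree-like Res$(\oplus)$ refutation is one in which every derived line is used at most once as a premise; size is the number of lines. $\tilde O(f)=O(f\log^C f)$, $\tilde\Omega(f)=\Omega(f/\log^C f)$ for some constant $C$. *)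

theory Defs
  imports Complex_Main "HOL-Library.Landau_Symbols"
begin

section \<open>Hitting formulas\<close>

text \<open>The literal \<open>(x, True)\<close> is the variable \<open>x\<close>, and \<open>(x, False)\<close> is its negation.\<close>

type_synonym literal = "nat \<times> bool"
type_synonym clause = "literal set"
type_synonym cnf = "clause set"

fun complement :: "literal \<Rightarrow> literal" where
  "complement (x, b) = (x, \<not> b)"

definition is_clause :: "clause \<Rightarrow> bool" where
  "is_clause C \<longleftrightarrow> finite C \<and> (\<forall>l\<in>C. complement l \<notin> C)"

definition is_cnf :: "cnf \<Rightarrow> bool" where
  "is_cnf F \<longleftrightarrow> finite F \<and> (\<forall>C\<in>F. is_clause C)"

definition width :: "clause \<Rightarrow> nat" where
  "width C = card C"

definition sat_clause :: "(nat \<Rightarrow> bool) \<Rightarrow> clause \<Rightarrow> bool" where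
  "sat_clause \<alpha> C \<longleftrightarrow> (\<exists>(x, b)\<in>C. \<alpha> x = b)"

definition unsatisfiable :: "cnf \<Rightarrow> bool" where
  "unsatisfiable F \<longleftrightarrow> \<not> (\<exists>\<alpha>. \<forall>C\<in>F. sat_clause \<alpha> C)"

definition hitting_formula :: "cnf \<Rightarrow> bool" where
  "hitting_formula F \<longleftrightarrow>
     is_cnf F \<and> (\<forall>C\<in>F. \<forall>D\<in>F. C \<noteq> D \<longrightarrow> (\<exists>l\<in>C. complement l \<in> D))"

section \<open>Resolution over linear clauses\<close>

text \<open>A finite set \<open>I\<close> of variables stands for the linear form \<open>\<Oplus>i\<in>I. x\<^sub>i\<close> over GF(2), and the
  pair \<open>(I, c)\<close> for the equation \<open>(\<Oplus>i\<in>I. x\<^sub>i) = c\<close>. The form \<open>{}\<close> is the zero form.\<close>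

type_synonym lin_form = "nat set"
type_synonym lin_eq = "lin_form \<times> bool"
type_synonym lin_clause = "lin_eq set"

definition is_lin_clause :: "lin_clause \<Rightarrow> bool" where
  "is_lin_clause L \<longleftrightarrow> finite L \<and> (\<forall>(I, c)\<in>L. finite I)"

definition lin_form_val :: "(nat \<Rightarrow> bool) \<Rightarrow> lin_form \<Rightarrow> bool" where
  "lin_form_val \<alpha> I \<longleftrightarrow> odd (card {i \<in> I. \<alpha> i})"

definition sat_lin_clause :: "(nat \<Rightarrow> bool) \<Rightarrow> lin_clause \<Rightarrow> bool" where
  "sat_lin_clause \<alpha> L \<longleftrightarrow> (\<exists>(I, c)\<in>L. lin_form_val \<alpha> I = c)"

definition lin_implies :: "lin_clause \<Rightarrow> lin_clause \<Rightarrow> bool" where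
  "lin_implies C D \<longleftrightarrow> (\<forall>\<alpha>. sat_lin_clause \<alpha> C \<longrightarrow> sat_lin_clause \<alpha> D)"

definition lin_of_clause :: "clause \<Rightarrow> lin_clause" where
  "lin_of_clause C = (\<lambda>(x, b). ({x}, b)) ` C"

text \<open>Disjunction is union, so the side clauses \<open>C\<close> and \<open>D\<close> may themselves contain the
  equation that is resolved upon.\<close>

definition resolvent :: "lin_clause \<Rightarrow> lin_clause \<Rightarrow> lin_clause \<Rightarrow> bool" where
  "resolvent P Q R \<longleftrightarrow>
     (\<exists>f C D. P = insert (f, False) C \<and> Q = insert (f, True) D \<and> R = C \<union> D)"

text \<open>A derivation is a list of lines, each with its justification; the numbers in a justification
  are the positions of the premises.\<close>

datatype justification = Input | Resolve nat nat | Weaken nat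

type_synonym derivation = "(lin_clause \<times> justification) list"

fun premise_lines :: "justification \<Rightarrow> nat list" where
  "premise_lines Input = []"
| "premise_lines (Resolve i j) = [i, j]"
| "premise_lines (Weaken i) = [i]"

fun justified :: "cnf \<Rightarrow> derivation \<Rightarrow> lin_clause \<Rightarrow> justification \<Rightarrow> bool" where
  "justified F \<pi> L Input \<longleftrightarrow> L \<in> lin_of_clause ` F"
| "justified F \<pi> L (Resolve i j) \<longleftrightarrow> resolvent (fst (\<pi> ! i)) (fst (\<pi> ! j)) L"
| "justified F \<pi> L (Weaken i) \<longleftrightarrow> lin_implies (fst (\<pi> ! i)) L"

definition is_derivation :: "cnf \<Rightarrow> derivation \<Rightarrow> bool" where
  "is_derivation F \<pi> \<longleftrightarrow>
     (\<forall>k<length \<pi>. is_lin_clause (fst (\<pi> ! k)) \<and>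
        (\<forall>i\<in>set (premise_lines (snd (\<pi> ! k))). i < k) \<and>
        justified F \<pi> (fst (\<pi> ! k)) (snd (\<pi> ! k)))"

definition is_refutation :: "cnf \<Rightarrow> derivation \<Rightarrow> bool" where
  "is_refutation F \<pi> \<longleftrightarrow> is_derivation F \<pi> \<and> {} \<in> fst ` set \<pi>"

text \<open>Only derived lines are restricted: a clause of the formula may be used several times.\<close>

definition tree_like :: "derivation \<Rightarrow> bool" where
  "tree_like \<pi> \<longleftrightarrow>
     (\<forall>k<length \<pi>. snd (\<pi> ! k) \<noteq> Input \<longrightarrow>
        count_list (concat (map (premise_lines \<circ> snd) \<pi>)) k \<le> 1)"

definition proof_size :: "derivation \<Rightarrow> nat" where
  "proof_size \<pi> = length \<pi>"

section \<open>Asymptotics up to logarithmic factors\<close>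

definition soft_O :: "(nat \<Rightarrow> real) \<Rightarrow> (nat \<Rightarrow> real) set" where
  "soft_O f = (\<Union>C::nat. O(\<lambda>n. f n * log 2 (f n) ^ C))"

text \<open>The library's \<open>\<Omega>\<close> compares absolute values, so nonnegativity is required separately to make
  membership a genuine lower bound.\<close>

definition soft_Omega :: "(nat \<Rightarrow> real) \<Rightarrow> (nat \<Rightarrow> real) set" where
  "soft_Omega f = {h. (\<forall>n. 0 \<le> h n) \<and> (\<exists>C::nat. h \<in> \<Omega>(\<lambda>n. f n / log 2 (f n) ^ C))}"

end

theory Submission
  imports Defs "HOL-Library.Countable"
begin

text \<open>The hitting formula comes from a Boolean function all of whose inputs have short unambiguous
  certificates (a partition of the cube into large subcubes) but which has large decision tree
  depth. Such functions are obtained by iterating \<open>f \<mapsto> \<not> CS(AND\<^sub>n \<circ> OR\<^sub>n \<circ> f)\<close>. The composition multiplies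
  the depth by \<open>n\<^sup>2\<close> and ordinary certificates by \<open>n\<close> only, and the cheat sheet construction \<open>CS\<close>
  turns the ordinary certificates of both values into unambiguous ones for the value true. With
  \<open>n = 2\<^sup>t\<close>, after \<open>k\<close> rounds the depth is \<open>n\<^sup>2\<^sup>k\<close>, and unambiguous certificates have size about
  \<open>n\<^sup>k\<^sup>+\<^sup>1\<close>, up to factors polynomial in \<open>t\<close>.

  Replacing every variable by a majority of three bits lifts decision tree depth to tree-like
  \<open>Res(\<oplus>)\<close> size: walking down from the empty clause, each linear equation is solved for one bit of a
  block whose two other bits already determine the majority, so one query to the adversary is paid
  for by a branching of the tree.\<close>

section \<open>Adversaries for decision trees\<close>

text \<open>Two obstacles shape the construction. Conjunction and disjunction treat the two values
  of a function differently: an unambiguous certificate of a true disjunction must also refute the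
  copies before the first true one. If false were the expensive value, each round would multiply the
  unambiguous certificates by about n^2, as fast as the depth, and nothing would be gained. The
  cheat sheet makes true cheap, and the negation hands this gain to false, the value that the next
  disjunction pays for n times. The expensive value is then paid once per disjunction and grows by a
  factor of about n per round.

  The other obstacle is the loss, in every round, of factors polynomial in t = log n: the length of
  an address and the number of bits that name a variable. As k is fixed by \<epsilon> before t
  grows, one spare factor n absorbs them all. Depth n^(2k) against width n^(k+2) yields the exponent
  2k/(k+2) = 2 - 4/(k+2).\<close>

definition agree :: "'v set \<Rightarrow> ('v \<Rightarrow> bool) \<Rightarrow> ('v \<Rightarrow> bool) \<Rightarrow> bool" where
  "agree S \<alpha> \<beta> \<longleftrightarrow> (\<forall>x\<in>S. \<alpha> x = \<beta> x)"

definition extends :: "('v \<Rightarrow> bool) \<Rightarrow> ('v \<rightharpoonup> bool) \<Rightarrow> bool" where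
  "extends \<alpha> \<rho> \<longleftrightarrow> (\<forall>x b. \<rho> x = Some b \<longrightarrow> \<alpha> x = b)"

text \<open>Decision tree depth at least d on the inputs that extend \<open>\<rho>\<close>, phrased
  as an adversary strategy: strategies on disjoint sets of variables can be played side by side,
  which is how composed functions are handled.\<close>

fun hard :: "(('v \<Rightarrow> bool) \<Rightarrow> bool) \<Rightarrow> nat \<Rightarrow> ('v \<rightharpoonup> bool) \<Rightarrow> bool" where
  "hard f 0 \<rho> \<longleftrightarrow> True"
| "hard f (Suc d) \<rho> \<longleftrightarrow>
     (\<exists>\<alpha>. extends \<alpha> \<rho> \<and> f \<alpha>) \<and> (\<exists>\<alpha>. extends \<alpha> \<rho> \<and> \<not> f \<alpha>) \<and>
     (\<forall>x. \<rho> x = None \<longrightarrow> (\<exists>b. hard f d (\<rho>(x \<mapsto> b))))"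

lemma hard_Suc_imp: "hard f (Suc d) \<rho> \<Longrightarrow> hard f d \<rho>"
proof (induction d arbitrary: \<rho>)
  case (Suc d)
  then show ?case using hard.simps(2)[of f "Suc d" \<rho>] hard.simps(2)[of f d \<rho>] by metis
qed simp

lemma hard_mono: "hard f d \<rho> \<Longrightarrow> e \<le> d \<Longrightarrow> hard f e \<rho>"
proof (induction d)
  case (Suc d)
  then show ?case using hard_Suc_imp le_Suc_eq by metis
qed simp

lemma hard_value:
  assumes "hard f d \<rho>" "0 < d"
  shows "\<exists>\<alpha>. extends \<alpha> \<rho> \<and> f \<alpha> = b"
  using assms by (cases d; cases b) auto

section \<open>Lifting by majority\<close>

definition majority :: "(nat \<Rightarrow> bool) \<Rightarrow> nat \<Rightarrow> bool" where
  "majority \<alpha> i \<longleftrightarrow>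
     \<alpha> (3*i) \<and> \<alpha> (3*i+1) \<or> \<alpha> (3*i) \<and> \<alpha> (3*i+2) \<or> \<alpha> (3*i+1) \<and> \<alpha> (3*i+2)"

section \<open>Affine maps over GF(2)\<close>

definition affine_map :: "((nat \<Rightarrow> bool) \<Rightarrow> bool) \<Rightarrow> bool" where
  "affine_map h \<longleftrightarrow> (\<exists>I c. finite I \<and> (\<forall>\<alpha>. h \<alpha> = (lin_form_val \<alpha> I \<noteq> c)))"

lemma lin_form_val_empty [simp]: "lin_form_val \<alpha> {} = False"
  by (simp add: lin_form_val_def)

lemma lin_form_val_insert:
  assumes "finite I" "x \<notin> I"
  shows "lin_form_val \<alpha> (insert x I) = (\<alpha> x \<noteq> lin_form_val \<alpha> I)"
proof (cases "\<alpha> x")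
  case True
  then have "{i \<in> insert x I. \<alpha> i} = insert x {i \<in> I. \<alpha> i}" by auto
  then show ?thesis using assms True by (simp add: lin_form_val_def)
next
  case False
  then have "{i \<in> insert x I. \<alpha> i} = {i \<in> I. \<alpha> i}" by auto
  then show ?thesis using False by (simp add: lin_form_val_def)
qed

lemma lin_form_val_toggle:
  assumes "finite I"
  shows "\<exists>J. finite J \<and> (\<forall>\<alpha>. lin_form_val \<alpha> J = (\<alpha> x \<noteq> lin_form_val \<alpha> I))"
proof (cases "x \<in> I")
  case True
  then have "lin_form_val \<alpha> I = (\<alpha> x \<noteq> lin_form_val \<alpha> (I - {x}))" for \<alpha>
    using lin_form_val_insert[of "I - {x}" x \<alpha>] assms by (simp add: insert_absorb)
  then show ?thesis using assms by (intro exI[of _ "I - {x}"]) auto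
next
  case False
  then show ?thesis using lin_form_val_insert[OF assms] assms
    by (intro exI[of _ "insert x I"]) auto
qed

lemma lin_form_val_xor:
  assumes "finite I" "finite J"
  shows "\<exists>K. finite K \<and> (\<forall>\<alpha>. lin_form_val \<alpha> K = (lin_form_val \<alpha> I \<noteq> lin_form_val \<alpha> J))"
  using assms(1)
proof (induction I)
  case empty
  then show ?case using assms(2) by auto
next
  case (insert x I)
  then obtain K where K: "finite K" "\<And>\<alpha>. lin_form_val \<alpha> K = (lin_form_val \<alpha> I \<noteq> lin_form_val \<alpha> J)"
    by auto
  obtain K' where "finite K'" "\<And>\<alpha>. lin_form_val \<alpha> K' = (\<alpha> x \<noteq> lin_form_val \<alpha> K)"
    using lin_form_val_toggle[OF K(1)] by metis
  then show ?case using K lin_form_val_insert[OF insert(1,2)] by (intro exI[of _ K']) auto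
qed

lemma affine_map_const: "affine_map (\<lambda>\<alpha>. b)"
  unfolding affine_map_def by (intro exI[of _ "{}"] exI[of _ b]) auto

lemma affine_map_var: "affine_map (\<lambda>\<alpha>. \<alpha> v)"
  unfolding affine_map_def
  by (intro exI[of _ "{v}"] exI[of _ False]) (simp add: lin_form_val_insert)

lemma affine_map_xor:
  assumes "affine_map g" "affine_map h"
  shows "affine_map (\<lambda>\<alpha>. g \<alpha> \<noteq> h \<alpha>)"
proof -
  obtain I c J d where *: "finite I" "\<And>\<alpha>. g \<alpha> = (lin_form_val \<alpha> I \<noteq> c)"
    "finite J" "\<And>\<alpha>. h \<alpha> = (lin_form_val \<alpha> J \<noteq> d)"
    using assms unfolding affine_map_def by metis
  obtain K where "finite K" "\<And>\<alpha>. lin_form_val \<alpha> K = (lin_form_val \<alpha> I \<noteq> lin_form_val \<alpha> J)"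
    using lin_form_val_xor[OF *(1,3)] by metis
  then show ?thesis unfolding affine_map_def using * by (intro exI[of _ K] exI[of _ "c \<noteq> d"]) auto
qed

lemma affine_map_lin_form:
  assumes "finite I" "\<And>v. affine_map (\<lambda>\<alpha>. \<phi> \<alpha> v)"
  shows "affine_map (\<lambda>\<alpha>. lin_form_val (\<phi> \<alpha>) I)"
  using assms(1)
proof (induction I)
  case (insert x I)
  then show ?case using affine_map_xor[OF assms(2) insert.IH] by (simp add: lin_form_val_insert)
qed (simp add: affine_map_const)

lemma affine_map_comp:
  assumes "affine_map h" "\<And>v. affine_map (\<lambda>\<alpha>. \<phi> \<alpha> v)"
  shows "affine_map (\<lambda>\<alpha>. h (\<phi> \<alpha>))"
proof -
  obtain I c where I: "finite I" "\<And>\<alpha>. h \<alpha> = (lin_form_val \<alpha> I \<noteq> c)"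
    using assms(1) unfolding affine_map_def by metis
  then show ?thesis
    using affine_map_xor[OF affine_map_lin_form[OF I(1) assms(2)] affine_map_const[of c]] by simp
qed

text \<open>Any member of the linear form serves as a pivot v. This is all the Gaussian elimination
  that the lifting needs.\<close>

lemma affine_map_cases:
  assumes "affine_map h"
  obtains (const) b where "\<And>\<alpha>. h \<alpha> = b"
  | (flip) v where "\<And>\<alpha>. h (\<alpha>(v := \<not> \<alpha> v)) = (\<not> h \<alpha>)"
proof -
  obtain I c where I: "finite I" "\<And>\<alpha>. h \<alpha> = (lin_form_val \<alpha> I \<noteq> c)"
    using assms unfolding affine_map_def by metis
  show ?thesis
  proof (cases "I = {}")
    case True
    then show ?thesis using const I by simp
  next
    case False
    then obtain v where v: "v \<in> I" by auto
    have *: "lin_form_val \<alpha> I = (\<alpha> v \<noteq> lin_form_val \<alpha> (I - {v}))" for \<alpha>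
      using lin_form_val_insert[of "I - {v}" v \<alpha>] I v by (simp add: insert_absorb)
    have "{i \<in> I - {v}. (\<alpha>(v := \<not> \<alpha> v)) i} = {i \<in> I - {v}. \<alpha> i}" for \<alpha> by auto
    then have rest: "lin_form_val (\<alpha>(v := \<not> \<alpha> v)) (I - {v}) = lin_form_val \<alpha> (I - {v})" for \<alpha>
      unfolding lin_form_val_def by presburger
    have "h (\<alpha>(v := \<not> \<alpha> v)) = (\<not> h \<alpha>)" for \<alpha>
      unfolding I(2) *[of \<alpha>] *[of "\<alpha>(v := \<not> \<alpha> v)"] rest fun_upd_same by blast
    then show ?thesis using flip[of v] by blast
  qed
qed

text \<open>The map \<open>\<phi>\<close> parametrizes an affine subspace: the blocks outside the domain of \<open>\<rho>\<close> are free,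
  and the others are affine functions of them whose majorities are frozen to \<open>\<rho>\<close>.\<close>

definition lifting :: "(nat \<rightharpoonup> bool) \<Rightarrow> ((nat \<Rightarrow> bool) \<Rightarrow> (nat \<Rightarrow> bool)) \<Rightarrow> bool" where
  "lifting \<rho> \<phi> \<longleftrightarrow>
     (\<forall>v. affine_map (\<lambda>\<alpha>. \<phi> \<alpha> v)) \<and>
     (\<forall>\<alpha> \<beta>. agree {v. \<rho> (v div 3) = None} \<alpha> \<beta> \<longrightarrow> \<phi> \<alpha> = \<phi> \<beta>) \<and>
     (\<forall>\<alpha> v. \<rho> (v div 3) = None \<longrightarrow> \<phi> \<alpha> v = \<alpha> v) \<and>
     (\<forall>\<alpha> i b. \<rho> i = Some b \<longrightarrow> majority (\<phi> \<alpha>) i = b)"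

lemma lifting_id: "lifting Map.empty (\<lambda>\<alpha>. \<alpha>)"
  unfolding lifting_def agree_def by (auto simp: affine_map_var)

text \<open>A free block can be filled with three copies of the wanted bit, so the subspace
  described by \<open>\<phi>\<close> reveals nothing about the majorities beyond
  \<open>\<rho>\<close>.\<close>

lemma lifting_realizes:
  assumes "lifting \<rho> \<phi>" "extends z \<rho>"
  shows "\<exists>\<alpha>. majority (\<phi> \<alpha>) = z"
proof -
  have "majority (\<phi> (\<lambda>v. z (v div 3))) i = z i" for i
  proof (cases "\<rho> i")
    case None
    then have "\<phi> (\<lambda>v. z (v div 3)) w = z i" if "w div 3 = i" for w
      using assms(1) that unfolding lifting_def by auto
    then show ?thesis unfolding majority_def by simp
  next
    case (Some b)
    then show ?thesis using assms unfolding lifting_def extends_def by auto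
  qed
  then show ?thesis by blast
qed

text \<open>Fixing two of the three bits of a block fixes its majority and leaves the third bit free to
  solve a new linear equation.\<close>

lemma lifting_step:
  assumes lift: "lifting \<rho> \<phi>" and h: "affine_map h"
    and flip: "\<And>\<alpha>. h (\<phi> (\<alpha>(v := \<not> \<alpha> v))) = (\<not> h (\<phi> \<alpha>))"
  shows "\<rho> (v div 3) = None"
    and "\<exists>\<phi>'. lifting (\<rho>(v div 3 \<mapsto> b)) \<phi>' \<and> range \<phi>' \<subseteq> range \<phi> \<and> (\<forall>\<alpha>. h (\<phi>' \<alpha>) = e)"
proof -
  have aff: "\<And>w. affine_map (\<lambda>\<alpha>. \<phi> \<alpha> w)"
    and dep: "\<And>\<alpha> \<beta>. agree {v. \<rho> (v div 3) = None} \<alpha> \<beta> \<Longrightarrow> \<phi> \<alpha> = \<phi> \<beta>"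
    and free: "\<And>\<alpha> w. \<rho> (w div 3) = None \<Longrightarrow> \<phi> \<alpha> w = \<alpha> w"
    and maj: "\<And>\<alpha> i b. \<rho> i = Some b \<Longrightarrow> majority (\<phi> \<alpha>) i = b"
    using lift unfolding lifting_def by blast+
  show none: "\<rho> (v div 3) = None"
  proof (rule ccontr)
    assume "\<rho> (v div 3) \<noteq> None"
    then have "\<phi> (\<alpha>(v := \<not> \<alpha> v)) = \<phi> \<alpha>" for \<alpha>
      by (intro dep) (auto simp: agree_def)
    then show False using flip by metis
  qed
  define \<sigma> where "\<sigma> \<alpha> = (\<lambda>w. if w div 3 = v div 3 then b else \<alpha> w)" for \<alpha> :: "nat \<Rightarrow> bool"
  \<comment> \<open>\<open>\<sigma>\<close> fills the block of v with b, and v is then flipped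
    exactly when h misses the value e. The other two bits remain b, so the majority is b in both
    cases. Since h is evaluated after \<open>\<sigma>\<close>, the new bit at v depends on no bit of
    its own block.\<close>
  define \<tau> where "\<tau> \<alpha> = (\<sigma> \<alpha>)(v := (b \<noteq> (h (\<phi> (\<sigma> \<alpha>)) \<noteq> e)))" for \<alpha>
  define \<phi>' where "\<phi>' \<alpha> = \<phi> (\<tau> \<alpha>)" for \<alpha>
  have aff_\<sigma>: "affine_map (\<lambda>\<alpha>. \<sigma> \<alpha> w)" for w
    unfolding \<sigma>_def by (cases "w div 3 = v div 3") (simp_all add: affine_map_const affine_map_var)
  have aff_h: "affine_map (\<lambda>\<alpha>. h (\<phi> (\<sigma> \<alpha>)))"
    using affine_map_comp[OF affine_map_comp[OF h aff] aff_\<sigma>] .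
  have aff_\<tau>: "affine_map (\<lambda>\<alpha>. \<tau> \<alpha> w)" for w
  proof (cases "w = v")
    case True
    then show ?thesis
      using affine_map_xor[OF affine_map_const[of b] affine_map_xor[OF aff_h affine_map_const[of e]]]
      by (simp add: \<tau>_def)
  next
    case False
    then show ?thesis using aff_\<sigma>[of w] by (simp add: \<tau>_def)
  qed
  have val: "h (\<phi>' \<alpha>) = e" for \<alpha>
  proof (cases "h (\<phi> (\<sigma> \<alpha>)) = e")
    case True
    then have "\<tau> \<alpha> = \<sigma> \<alpha>" unfolding \<tau>_def \<sigma>_def by (auto intro!: ext split: if_splits)
    then show ?thesis using True by (simp add: \<phi>'_def)
  next
    case False
    then have "\<tau> \<alpha> = (\<sigma> \<alpha>)(v := \<not> \<sigma> \<alpha> v)" unfolding \<tau>_def \<sigma>_def by auto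
    then show ?thesis using False flip[of "\<sigma> \<alpha>"] by (simp add: \<phi>'_def)
  qed
  have "lifting (\<rho>(v div 3 \<mapsto> b)) \<phi>'"
    unfolding lifting_def
  proof (intro conjI allI impI)
    fix w show "affine_map (\<lambda>\<alpha>. \<phi>' \<alpha> w)"
      unfolding \<phi>'_def using affine_map_comp[OF aff aff_\<tau>] .
  next
    fix \<alpha> \<beta> assume ag: "agree {w. (\<rho>(v div 3 \<mapsto> b)) (w div 3) = None} \<alpha> \<beta>"
    have "\<phi> (\<sigma> \<alpha>) = \<phi> (\<sigma> \<beta>)"
      by (rule dep) (use ag in \<open>auto simp: agree_def \<sigma>_def\<close>)
    moreover from this have "\<phi> (\<tau> \<alpha>) = \<phi> (\<tau> \<beta>)"
      by (intro dep) (use ag in \<open>auto simp: agree_def \<tau>_def \<sigma>_def\<close>)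
    ultimately show "\<phi>' \<alpha> = \<phi>' \<beta>" by (simp add: \<phi>'_def)
  next
    fix \<alpha> w assume "(\<rho>(v div 3 \<mapsto> b)) (w div 3) = None"
    then have "\<rho> (w div 3) = None" "w div 3 \<noteq> v div 3" by (auto split: if_splits)
    then show "\<phi>' \<alpha> w = \<alpha> w" using free by (auto simp: \<phi>'_def \<tau>_def \<sigma>_def)
  next
    fix \<alpha> i c assume c: "(\<rho>(v div 3 \<mapsto> b)) i = Some c"
    show "majority (\<phi>' \<alpha>) i = c"
    proof (cases "i = v div 3")
      case True
      define q where "q = v div 3"
      have "\<phi>' \<alpha> w = \<tau> \<alpha> w" if "w div 3 = q" for w
        using free none that by (simp add: \<phi>'_def q_def)
      moreover have "\<tau> \<alpha> w = b" if "w div 3 = q" "w \<noteq> v" for w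
        using that by (simp add: \<tau>_def \<sigma>_def q_def)
      moreover have "v = 3*q \<or> v = 3*q+1 \<or> v = 3*q+2" unfolding q_def by presburger
      ultimately show ?thesis using True c unfolding majority_def q_def[symmetric] by auto
    next
      case False
      then show ?thesis using maj c by (simp add: \<phi>'_def)
    qed
  qed
  moreover have "range \<phi>' \<subseteq> range \<phi>" by (auto simp: \<phi>'_def)
  ultimately show "\<exists>\<phi>'. lifting (\<rho>(v div 3 \<mapsto> b)) \<phi>' \<and> range \<phi>' \<subseteq> range \<phi> \<and> (\<forall>\<alpha>. h (\<phi>' \<alpha>) = e)"
    using val by blast
qed

text \<open>Leaves of the proof unfolded into a tree. The guards serve termination: in a derivation
  every premise precedes its line.\<close>

function leaves :: "derivation \<Rightarrow> nat \<Rightarrow> nat" where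
  "leaves \<pi> k = (case snd (\<pi> ! k) of
      Input \<Rightarrow> 1
    | Resolve i j \<Rightarrow> if i < k \<and> j < k then leaves \<pi> i + leaves \<pi> j else 1
    | Weaken i \<Rightarrow> if i < k then leaves \<pi> i else 1)"
  by pat_completeness auto
termination by (relation "measure snd") auto

declare leaves.simps [simp del]

lemma leaves_pos: "1 \<le> leaves \<pi> k"
proof (induction k rule: less_induct)
  case (less k)
  then show ?case by (subst leaves.simps) (force split: justification.split)
qed

lemma sat_lin_of_clause: "sat_lin_clause \<alpha> (lin_of_clause C) = sat_clause \<alpha> C"
proof -
  have "lin_form_val \<alpha> {x} = \<alpha> x" for x
    using lin_form_val_insert[of "{}" x \<alpha>] by simp
  then show ?thesis
    unfolding sat_lin_clause_def lin_of_clause_def sat_clause_def by (auto split: prod.splits) 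
qed

text \<open>The descent maintains an affine subspace on which the current line is falsified and an
  adversary position that survives r more queries. If the resolved form is constant on the subspace,
  one premise is followed free of charge; otherwise one query is spent and both premises stay
  reachable, which doubles the count. A clause of G determines the value of f, whereas r > 0 would
  leave both values possible, so r = 0 there.\<close>

lemma leaves_lower_bound:
  assumes der: "is_derivation G \<pi>"
    and const: "\<And>C \<alpha> \<beta>. C \<in> G \<Longrightarrow> \<not> sat_clause \<alpha> C \<Longrightarrow> \<not> sat_clause \<beta> C \<Longrightarrow>
      f (majority \<alpha>) = f (majority \<beta>)"
  shows "k < length \<pi> \<Longrightarrow> hard f r \<rho> \<Longrightarrow> lifting \<rho> \<phi> \<Longrightarrow>
    (\<And>\<alpha>. \<not> sat_lin_clause (\<phi> \<alpha>) (fst (\<pi> ! k))) \<Longrightarrow> 2 ^ r \<le> leaves \<pi> k"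
proof (induction k arbitrary: r \<rho> \<phi> rule: less_induct)
  case (less k)
  note k = less.prems(1) and hard = less.prems(2) and lift = less.prems(3) and fals = less.prems(4)
  have line: "is_lin_clause (fst (\<pi> ! k))"
    "\<And>i. i \<in> set (premise_lines (snd (\<pi> ! k))) \<Longrightarrow> i < k"
    "justified G \<pi> (fst (\<pi> ! k)) (snd (\<pi> ! k))"
    using der k unfolding is_derivation_def by blast+
  show ?case
  proof (cases "snd (\<pi> ! k)")
    case Input
    then obtain C where C: "C \<in> G" "fst (\<pi> ! k) = lin_of_clause C" using line(3) by auto
    have same: "f (majority (\<phi> \<alpha>)) = f (majority (\<phi> \<beta>))" for \<alpha> \<beta>
      using const[OF C(1)] fals C(2) sat_lin_of_clause by metis
    have "r = 0"
    proof (rule ccontr)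
      assume "r \<noteq> 0"
      then obtain y z where "extends y \<rho>" "f y" "extends z \<rho>" "\<not> f z"
        using hard_value[OF hard] by (metis (full_types) gr0I)
      then show False using lifting_realizes[OF lift] same by metis
    qed
    then show ?thesis using leaves_pos[of \<pi> k] by simp
  next
    case (Weaken i)
    then have i: "i < k" "lin_implies (fst (\<pi> ! i)) (fst (\<pi> ! k))" using line by auto
    then have "2 ^ r \<le> leaves \<pi> i"
      using fals k by (intro less.IH[OF _ _ hard lift]) (auto simp: lin_implies_def)
    then show ?thesis using Weaken i by (subst leaves.simps) simp
  next
    case (Resolve i j)
    then have ij: "i < k" "j < k" "resolvent (fst (\<pi> ! i)) (fst (\<pi> ! j)) (fst (\<pi> ! k))"
      using line by auto
    then obtain I C D where R: "fst (\<pi> ! i) = insert (I, False) C"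
      "fst (\<pi> ! j) = insert (I, True) D" "fst (\<pi> ! k) = C \<union> D"
      unfolding resolvent_def by blast
    have L: "leaves \<pi> k = leaves \<pi> i + leaves \<pi> j"
      using Resolve ij by (subst leaves.simps) simp
    have "is_lin_clause (fst (\<pi> ! i))" using der ij(1) k unfolding is_derivation_def by force
    then have finI: "finite I" using R(1) unfolding is_lin_clause_def by auto
    have left: "2 ^ s \<le> leaves \<pi> i"
      if hl: "hard f s \<rho>'" "lifting \<rho>' \<psi>" and sub: "range \<psi> \<subseteq> range \<phi>" and val: "\<And>\<alpha>. lin_form_val (\<psi> \<alpha>) I"
      for s \<rho>' \<psi>
    proof (rule less.IH[OF ij(1) _ hl])
      fix \<alpha>
      obtain \<beta> where "\<psi> \<alpha> = \<phi> \<beta>" using sub by blast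
      then show "\<not> sat_lin_clause (\<psi> \<alpha>) (fst (\<pi> ! i))"
        using fals[of \<beta>] val[of \<alpha>] R unfolding sat_lin_clause_def by auto
    qed (use ij k in simp)
    have right: "2 ^ s \<le> leaves \<pi> j"
      if hl: "hard f s \<rho>'" "lifting \<rho>' \<psi>" and sub: "range \<psi> \<subseteq> range \<phi>" and val: "\<And>\<alpha>. \<not> lin_form_val (\<psi> \<alpha>) I"
      for s \<rho>' \<psi>
    proof (rule less.IH[OF ij(2) _ hl])
      fix \<alpha>
      obtain \<beta> where "\<psi> \<alpha> = \<phi> \<beta>" using sub by blast
      then show "\<not> sat_lin_clause (\<psi> \<alpha>) (fst (\<pi> ! j))"
        using fals[of \<beta>] val[of \<alpha>] R unfolding sat_lin_clause_def by auto
    qed (use ij k in simp)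
    have aff: "affine_map (\<lambda>\<alpha>. lin_form_val \<alpha> I)"
      using affine_map_lin_form[OF finI, of "\<lambda>\<alpha>. \<alpha>"] affine_map_var by blast
    have affc: "affine_map (\<lambda>\<alpha>. lin_form_val (\<phi> \<alpha>) I)"
      using affine_map_lin_form[OF finI] lift unfolding lifting_def by blast
    from affc show ?thesis
    proof (cases rule: affine_map_cases)
      case (const b)
      show ?thesis
      proof (cases b)
        case True
        then have "2 ^ r \<le> leaves \<pi> i" using const by (intro left[OF hard lift]) auto
        then show ?thesis using L by simp
      next
        case False
        then have "2 ^ r \<le> leaves \<pi> j" using const by (intro right[OF hard lift]) auto
        then show ?thesis using L by simp
      qed
    next
      case (flip v)
      show ?thesis
      proof (cases r)
        case 0
        then show ?thesis using leaves_pos[of \<pi> k] by simp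
      next
        case (Suc s)
        note step = lifting_step[of \<rho> \<phi> "\<lambda>\<alpha>. lin_form_val \<alpha> I" v, OF lift aff, simplified, OF flip]
        \<comment> \<open>The answer b is fixed before the value of the form is chosen, so both
          premises continue from the same extended \<open>\<rho>\<close>, each with hardness
          s.\<close>
        obtain b where b: "hard f s (\<rho>(v div 3 \<mapsto> b))" using hard step(1) Suc by auto
        obtain \<phi>1 where p1: "lifting (\<rho>(v div 3 \<mapsto> b)) \<phi>1" "range \<phi>1 \<subseteq> range \<phi>"
          "\<And>\<alpha>. lin_form_val (\<phi>1 \<alpha>) I" using step(2)[of b True] by (elim exE conjE) simp
        obtain \<phi>2 where p2: "lifting (\<rho>(v div 3 \<mapsto> b)) \<phi>2" "range \<phi>2 \<subseteq> range \<phi>"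
          "\<And>\<alpha>. \<not> lin_form_val (\<phi>2 \<alpha>) I" using step(2)[of b False] by (elim exE conjE) simp
        show ?thesis
          using add_mono[OF left[OF b p1] right[OF b p2]] unfolding L Suc by simp
      qed
    qed
  qed
qed

section \<open>Amortized counting in tree-like proofs\<close>

definition used_before :: "derivation \<Rightarrow> nat \<Rightarrow> nat \<Rightarrow> bool" where
  "used_before \<pi> p k \<longleftrightarrow> (\<exists>q<p. k \<in> set (premise_lines (snd (\<pi> ! q))))"

definition open_lines :: "derivation \<Rightarrow> nat \<Rightarrow> nat set" where
  "open_lines \<pi> p = {k. k < p \<and> snd (\<pi> ! k) \<noteq> Input \<and> \<not> used_before \<pi> p k}"

lemma count_list_concat:
  "count_list (concat xss) k = (\<Sum>i<length xss. count_list (xss ! i) k)"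
proof -
  have "count_list (concat xss) k = sum_list (map (\<lambda>xs. count_list xs k) xss)"
    by (induction xss) auto
  then show ?thesis by (simp add: sum_list_sum_nth atLeast0LessThan)
qed

lemma tree_like_use_once:
  assumes "tree_like \<pi>" "p < length \<pi>" "k < p" "snd (\<pi> ! k) \<noteq> Input"
    "k \<in> set (premise_lines (snd (\<pi> ! p)))"
  shows "\<not> used_before \<pi> p k" and "snd (\<pi> ! p) \<noteq> Resolve k k"
proof -
  let ?xss = "map (premise_lines \<circ> snd) \<pi>"
  have le: "count_list (concat ?xss) k \<le> 1"
    using assms unfolding tree_like_def by auto
  have pos: "1 \<le> count_list xs k" if "k \<in> set xs" for xs
    using that count_list_0_iff[of xs k] by (cases "count_list xs k") auto
  show "\<not> used_before \<pi> p k"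
  proof
    assume "used_before \<pi> p k"
    then obtain q where q: "q < p" "k \<in> set (premise_lines (snd (\<pi> ! q)))"
      unfolding used_before_def by blast
    have "(\<Sum>i\<in>{p, q}. count_list (?xss ! i) k) \<le> count_list (concat ?xss) k"
      unfolding count_list_concat using q(1) assms(2) by (intro sum_mono2) auto
    then show False
      using q(1) pos[OF q(2)] pos[OF assms(5)] le assms(2) by simp
  qed
  show "snd (\<pi> ! p) \<noteq> Resolve k k"
  proof
    assume r: "snd (\<pi> ! p) = Resolve k k"
    have "count_list (concat ?xss) k \<ge> count_list (?xss ! p) k"
      unfolding count_list_concat using assms(2) by (intro member_le_sum) auto
    then show False using le r assms(2) by simp
  qed
qed

lemma open_lines_Suc:
  "open_lines \<pi> (Suc p) \<subseteq> insert p (open_lines \<pi> p - set (premise_lines (snd (\<pi> ! p))))"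
proof
  fix k assume k: "k \<in> open_lines \<pi> (Suc p)"
  then have "\<not> used_before \<pi> p k" "k \<notin> set (premise_lines (snd (\<pi> ! p)))"
    unfolding open_lines_def used_before_def by (blast intro: less_SucI)+
  then show "k \<in> insert p (open_lines \<pi> p - set (premise_lines (snd (\<pi> ! p))))"
    using k unfolding open_lines_def by (simp add: less_Suc_eq) blast
qed

text \<open>Amortization over prefixes: a line enters the sum when derived and leaves it when used.\<close>

lemma open_leaves_le:
  assumes der: "is_derivation G \<pi>" and tree: "tree_like \<pi>"
  shows "p < length \<pi> \<Longrightarrow> (\<Sum>k\<in>open_lines \<pi> (Suc p). leaves \<pi> k - 1) \<le> p"
proof (induction p)
  case 0
  have "set (premise_lines (snd (\<pi> ! 0))) = {}"
    using der 0 unfolding is_derivation_def by fastforce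
  then have "snd (\<pi> ! 0) = Input" by (cases "snd (\<pi> ! 0)") auto
  then have "open_lines \<pi> (Suc 0) = {}" unfolding open_lines_def by auto
  then show ?case by simp
next
  case (Suc p)
  define q where "q = Suc p"
  \<comment> \<open>With 1 subtracted, clauses of the formula weigh 0 and may be reused freely, a
    weakening keeps the weight of its premise, and a resolution adds exactly 1 to the weights of its
    premises.\<close>
  define w where "w k = leaves \<pi> k - 1" for k
  define J where "J = {k \<in> set (premise_lines (snd (\<pi> ! q))). snd (\<pi> ! k) \<noteq> Input}"
  have q: "q < length \<pi>" "\<And>i. i \<in> set (premise_lines (snd (\<pi> ! q))) \<Longrightarrow> i < q"
    using der Suc.prems unfolding is_derivation_def q_def by blast+
  have fin: "finite (open_lines \<pi> n)" for n unfolding open_lines_def by simp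
  have J: "J \<subseteq> open_lines \<pi> q"
    using tree_like_use_once(1)[OF tree q(1)] q(2) unfolding J_def open_lines_def by auto
  have "q \<notin> open_lines \<pi> q" unfolding open_lines_def by simp
  have "open_lines \<pi> (Suc q) \<subseteq> insert q (open_lines \<pi> q - J)"
    using open_lines_Suc[of \<pi> q] unfolding J_def by blast
  then have "(\<Sum>k\<in>open_lines \<pi> (Suc q). w k) \<le> (\<Sum>k\<in>insert q (open_lines \<pi> q - J). w k)"
    by (intro sum_mono2) (use fin in auto)
  also have "\<dots> = w q + (\<Sum>k\<in>open_lines \<pi> q - J. w k)"
    using fin \<open>q \<notin> open_lines \<pi> q\<close> by (subst sum.insert) auto
  also have "\<dots> \<le> (1 + (\<Sum>k\<in>J. w k)) + (\<Sum>k\<in>open_lines \<pi> q - J. w k)"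
  proof (rule add_right_mono)
    have inp: "w k = 0" if "snd (\<pi> ! k) = Input" for k
      using that unfolding w_def by (subst leaves.simps) simp
    show "w q \<le> 1 + (\<Sum>k\<in>J. w k)"
    proof (cases "snd (\<pi> ! q)")
      case Input
      then show ?thesis using inp by simp
    next
      case (Weaken i)
      then have "leaves \<pi> q = leaves \<pi> i" using q(2) by (subst leaves.simps) simp
      then have "w q = w i" unfolding w_def by simp
      moreover have "J = (if snd (\<pi> ! i) = Input then {} else {i})"
        using Weaken unfolding J_def by auto
      ultimately show ?thesis using inp by simp
    next
      case (Resolve i j)
      then have "leaves \<pi> q = leaves \<pi> i + leaves \<pi> j" using q(2) by (subst leaves.simps) simp
      then have wq: "w q = 1 + (w i + w j)"
        using leaves_pos[of \<pi> i] leaves_pos[of \<pi> j] unfolding w_def by simp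
      have ne: "i \<noteq> j" if "snd (\<pi> ! i) \<noteq> Input"
        using tree_like_use_once(2)[OF tree q(1) _ that] q(2) Resolve by auto
      have "J = {k \<in> {i, j}. snd (\<pi> ! k) \<noteq> Input}" using Resolve unfolding J_def by auto
      moreover have "(\<Sum>k\<in>{k \<in> {i, j}. snd (\<pi> ! k) \<noteq> Input}. w k) = (\<Sum>k\<in>{i, j}. w k)"
        by (rule sum.mono_neutral_left) (use inp in auto)
      moreover have "(\<Sum>k\<in>{i, j}. w k) = w i + w j"
        using ne inp by (cases "i = j") auto
      ultimately show ?thesis using wq by simp
    qed
  qed
  also have "\<dots> = 1 + (\<Sum>k\<in>open_lines \<pi> q. w k)"
    using J fin sum.subset_diff[of J "open_lines \<pi> q" w] by simp
  also have "\<dots> \<le> 1 + p" using Suc.IH Suc.prems unfolding q_def w_def by simp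
  finally show ?case by (simp add: q_def w_def)
qed

lemma leaves_le_length:
  assumes "is_derivation G \<pi>" "tree_like \<pi>" "k < length \<pi>"
  shows "leaves \<pi> k \<le> length \<pi>"
proof (cases "snd (\<pi> ! k) = Input")
  case True
  then have "leaves \<pi> k = 1" by (subst leaves.simps) simp
  then show ?thesis using assms(3) by simp
next
  case False
  have "\<not> used_before \<pi> (Suc k) k"
    using assms(1,3) unfolding used_before_def is_derivation_def
    by (metis less_Suc_eq less_trans not_less_iff_gr_or_eq)
  then have "k \<in> open_lines \<pi> (Suc k)" using False unfolding open_lines_def by simp
  moreover have "finite (open_lines \<pi> (Suc k))" unfolding open_lines_def by simp
  ultimately have "leaves \<pi> k - 1 \<le> (\<Sum>k\<in>open_lines \<pi> (Suc k). leaves \<pi> k - 1)"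
    by (intro member_le_sum) auto
  then show ?thesis using open_leaves_le[OF assms] assms(3) by simp
qed

lemma tree_like_size_lower_bound:
  assumes "is_refutation G \<pi>" "tree_like \<pi>" "hard f d Map.empty"
    and "\<And>C \<alpha> \<beta>. C \<in> G \<Longrightarrow> \<not> sat_clause \<alpha> C \<Longrightarrow> \<not> sat_clause \<beta> C \<Longrightarrow>
      f (majority \<alpha>) = f (majority \<beta>)"
  shows "2 ^ d \<le> proof_size \<pi>"
proof -
  obtain k where k: "k < length \<pi>" "fst (\<pi> ! k) = {}"
    using assms(1) unfolding is_refutation_def by (metis (no_types, lifting) imageE in_set_conv_nth)
  have der: "is_derivation G \<pi>" using assms(1) unfolding is_refutation_def by blast
  have "2 ^ d \<le> leaves \<pi> k"
    by (rule leaves_lower_bound[OF der assms(4) k(1) assms(3) lifting_id])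
      (auto simp: k sat_lin_clause_def)
  then show ?thesis using leaves_le_length[OF der assms(2) k(1)] unfolding proof_size_def by simp
qed

section \<open>Certificates and unambiguous certificates\<close>

definition certifies :: "(('v \<Rightarrow> bool) \<Rightarrow> bool) \<Rightarrow> 'v set \<Rightarrow> ('v \<Rightarrow> bool) \<Rightarrow> bool" where
  "certifies f S \<alpha> \<longleftrightarrow> (\<forall>\<beta>. agree S \<alpha> \<beta> \<longrightarrow> f \<beta> = f \<alpha>)"

text \<open>\<open>U \<alpha>\<close> is the set of variables fixed by the subcube around \<open>\<alpha>\<close>; the condition on \<open>U\<close>
  says that these subcubes partition the cube.\<close>

definition unambiguous :: "(('v \<Rightarrow> bool) \<Rightarrow> bool) \<Rightarrow> (('v \<Rightarrow> bool) \<Rightarrow> 'v set) \<Rightarrow> bool" where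
  "unambiguous f U \<longleftrightarrow> (\<forall>\<alpha> \<beta>. agree (U \<alpha>) \<alpha> \<beta> \<longrightarrow> f \<beta> = f \<alpha> \<and> U \<beta> = U \<alpha>)"

text \<open>The certificate bounds c and u depend on the value of the function because conjunction,
  negation and cheat sheets act differently on the two values.\<close>

definition complexity_bounds ::
  "(('v \<Rightarrow> bool) \<Rightarrow> bool) \<Rightarrow> 'v set \<Rightarrow> nat \<Rightarrow> (bool \<Rightarrow> nat) \<Rightarrow> (bool \<Rightarrow> nat) \<Rightarrow> bool" where
  "complexity_bounds f V d c u \<longleftrightarrow>
     finite V \<and> hard f d Map.empty \<and>
     (\<forall>\<alpha>. \<exists>S\<subseteq>V. card S \<le> c (f \<alpha>) \<and> certifies f S \<alpha>) \<and>
     (\<exists>U. unambiguous f U \<and> (\<forall>\<alpha>. U \<alpha> \<subseteq> V \<and> card (U \<alpha>) \<le> u (f \<alpha>)))"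

lemma agreeD: "agree S \<alpha> \<beta> \<Longrightarrow> x \<in> S \<Longrightarrow> \<alpha> x = \<beta> x"
  by (simp add: agree_def)

lemma agree_image: "agree (e ` S) \<alpha> \<beta> \<longleftrightarrow> agree S (\<lambda>x. \<alpha> (e x)) (\<lambda>x. \<beta> (e x))"
  by (auto simp: agree_def)

text \<open>Checking whether S is a certificate reads the input only on S, once the value of f is
  known. This is why a certificate for the cheat sheet function can verify the addressed cell
  cheaply, whether the outcome is positive or negative.\<close>

lemma certifies_agree:
  assumes "agree S \<alpha> \<beta>" "f \<alpha> = f \<beta>"
  shows "certifies f S \<alpha> \<longleftrightarrow> certifies f S \<beta>"
proof -
  have "agree S \<alpha> \<gamma> \<longleftrightarrow> agree S \<beta> \<gamma>" for \<gamma>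
    using assms(1) unfolding agree_def by auto
  then show ?thesis using assms(2) unfolding certifies_def by simp
qed

lemma complexity_bounds_mono:
  assumes "complexity_bounds f V d c u" "\<And>b. c b \<le> c' b" "\<And>b. u b \<le> u' b" "d' \<le> d"
  shows "complexity_bounds f V d' c' u'"
proof -
  note f = assms(1)[unfolded complexity_bounds_def]
  have "\<exists>S\<subseteq>V. card S \<le> c' (f \<alpha>) \<and> certifies f S \<alpha>" for \<alpha>
  proof -
    obtain S where "S \<subseteq> V" "card S \<le> c (f \<alpha>)" "certifies f S \<alpha>" using f by blast
    then show ?thesis using order_trans[OF _ assms(2)] by blast
  qed
  moreover have "\<exists>U. unambiguous f U \<and> (\<forall>\<alpha>. U \<alpha> \<subseteq> V \<and> card (U \<alpha>) \<le> u' (f \<alpha>))"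
  proof -
    obtain U where "unambiguous f U" "\<And>\<alpha>. U \<alpha> \<subseteq> V" "\<And>\<alpha>. card (U \<alpha>) \<le> u (f \<alpha>)" using f by blast
    then show ?thesis using order_trans[OF _ assms(3)] by blast
  qed
  moreover have "hard f d' Map.empty" using f hard_mono assms(4) by blast
  ultimately show ?thesis using f unfolding complexity_bounds_def by blast
qed

lemma complexity_bounds_var: "complexity_bounds (\<lambda>\<alpha>. \<alpha> x) {x} 1 (\<lambda>_. 1) (\<lambda>_. 1)"
proof -
  have "extends (\<lambda>_. b) Map.empty" for b :: bool by (simp add: extends_def)
  then have "hard (\<lambda>\<alpha>. \<alpha> x) 1 Map.empty" by (auto simp: extends_def)
  moreover have "certifies (\<lambda>\<alpha>. \<alpha> x) {x} \<alpha>" for \<alpha> by (auto simp: certifies_def agree_def)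
  moreover have "unambiguous (\<lambda>\<alpha>. \<alpha> x) (\<lambda>_. {x})" by (auto simp: unambiguous_def agree_def)
  ultimately show ?thesis unfolding complexity_bounds_def
    by (intro conjI allI exI[of _ "{x}"] exI[of _ "\<lambda>_. {x}"]) auto
qed

lemma hard_not: "hard (\<lambda>\<alpha>. \<not> f \<alpha>) d \<rho> = hard f d \<rho>"
  by (induction d arbitrary: \<rho>) auto

lemma complexity_bounds_not:
  assumes "complexity_bounds f V d c u"
  shows "complexity_bounds (\<lambda>\<alpha>. \<not> f \<alpha>) V d (\<lambda>b. c (\<not> b)) (\<lambda>b. u (\<not> b))"
  using assms unfolding complexity_bounds_def hard_not certifies_def unambiguous_def by simp

text \<open>A query outside the range of e is answered True; it leaves the position in the game on f
  unchanged and merely uses up one unit of d.\<close>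

lemma hard_transport:
  assumes "inj e"
  shows "hard f d (\<rho> \<circ> e) \<Longrightarrow> hard (\<lambda>\<alpha>. f (\<lambda>x. \<alpha> (e x))) d \<rho>"
proof (induction d arbitrary: \<rho>)
  case (Suc d)
  have ext: "\<exists>\<beta>. extends \<beta> \<rho> \<and> (\<lambda>x. \<beta> (e x)) = \<alpha>" if "extends \<alpha> (\<rho> \<circ> e)" for \<alpha>
    using that assms
    by (intro exI[of _ "\<lambda>y. if y \<in> range e then \<alpha> (inv e y) else \<rho> y = Some True"])
      (auto simp: extends_def)
  have "\<exists>b. hard (\<lambda>\<alpha>. f (\<lambda>x. \<alpha> (e x))) d (\<rho>(y \<mapsto> b))" if "\<rho> y = None" for y
  proof (cases "y \<in> range e")
    case True
    then obtain x where x: "y = e x" by blast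
    then have "(\<rho> \<circ> e) x = None" using that by simp
    then obtain b where b: "hard f d ((\<rho> \<circ> e)(x \<mapsto> b))" using Suc.prems by (metis hard.simps(2))
    have "\<rho>(y \<mapsto> b) \<circ> e = (\<rho> \<circ> e)(x \<mapsto> b)"
      using x assms by (auto simp: fun_eq_iff inj_eq)
    then have "hard f d (\<rho>(y \<mapsto> b) \<circ> e)" using b by (simp only:)
    then show ?thesis by (intro exI Suc.IH)
  next
    case False
    then have "\<rho>(y \<mapsto> True) \<circ> e = \<rho> \<circ> e" by (auto simp: fun_eq_iff)
    then have "hard f d (\<rho>(y \<mapsto> True) \<circ> e)" using hard_Suc_imp[OF Suc.prems] by (simp only:)
    then show ?thesis by (intro exI Suc.IH)
  qed
  moreover have "\<exists>\<alpha>. extends \<alpha> \<rho> \<and> f (\<lambda>x. \<alpha> (e x)) = b" for b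
  proof -
    obtain \<alpha> where "extends \<alpha> (\<rho> \<circ> e)" "f \<alpha> = b" using hard_value[OF Suc.prems, of b] by blast
    then show ?thesis using ext[of \<alpha>] by blast
  qed
  from this[of True] this[of False]
  have "\<exists>\<alpha>. extends \<alpha> \<rho> \<and> f (\<lambda>x. \<alpha> (e x))" "\<exists>\<alpha>. extends \<alpha> \<rho> \<and> \<not> f (\<lambda>x. \<alpha> (e x))" by simp_all
  ultimately show ?case unfolding hard.simps by blast
qed simp

text \<open>This lets each round of the iteration return to natural numbers as variables.\<close>

lemma complexity_bounds_transport:
  assumes "complexity_bounds f V d c u" "inj e"
  shows "complexity_bounds (\<lambda>\<alpha>. f (\<lambda>x. \<alpha> (e x))) (e ` V) d c u"
proof -
  let ?r = "\<lambda>\<alpha> x. \<alpha> (e x)"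
  have fin: "finite V" and hard: "hard f d Map.empty"
    using assms(1) unfolding complexity_bounds_def by auto
  obtain S where S: "\<And>\<alpha>. S \<alpha> \<subseteq> V" "\<And>\<alpha>. card (S \<alpha>) \<le> c (f \<alpha>)" "\<And>\<alpha>. certifies f (S \<alpha>) \<alpha>"
    using assms(1) unfolding complexity_bounds_def by metis
  obtain U where U: "unambiguous f U" "\<And>\<alpha>. U \<alpha> \<subseteq> V" "\<And>\<alpha>. card (U \<alpha>) \<le> u (f \<alpha>)"
    using assms(1) unfolding complexity_bounds_def by metis
  have "hard (\<lambda>\<alpha>. f (?r \<alpha>)) d Map.empty"
    using hard by (intro hard_transport[OF assms(2)]) (simp add: comp_def)
  moreover have card: "card (e ` X) = card X" for X
    using assms(2) by (meson card_image inj_on_subset subset_UNIV)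
  moreover have "certifies (\<lambda>\<alpha>. f (?r \<alpha>)) (e ` S (?r \<alpha>)) \<alpha>" for \<alpha>
    using S(3)[of "?r \<alpha>"] unfolding certifies_def agree_image by blast
  moreover have "unambiguous (\<lambda>\<alpha>. f (?r \<alpha>)) (\<lambda>\<alpha>. e ` U (?r \<alpha>))"
    using U(1) unfolding unambiguous_def agree_image by metis
  moreover have "e ` S \<alpha> \<subseteq> e ` V" "e ` U \<alpha> \<subseteq> e ` V" for \<alpha>
    using S(1)[of \<alpha>] U(2)[of \<alpha>] by (simp_all add: image_mono)
  ultimately show ?thesis
    unfolding complexity_bounds_def using S(2) U(3)
    by (intro conjI allI exI[of _ "\<lambda>\<alpha>. e ` U (?r \<alpha>)"] exI[of _ "e ` S (?r _)"])
      (simp_all only: finite_imageI[OF fin])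
qed

section \<open>Conjunctions\<close>

definition all_copies :: "nat \<Rightarrow> (('v \<Rightarrow> bool) \<Rightarrow> bool) \<Rightarrow> (nat \<times> 'v \<Rightarrow> bool) \<Rightarrow> bool" where
  "all_copies n f \<alpha> \<longleftrightarrow> (\<forall>i<n. f (\<lambda>x. \<alpha> (i, x)))"

definition slice :: "nat \<Rightarrow> (nat \<times> 'v \<rightharpoonup> bool) \<Rightarrow> ('v \<rightharpoonup> bool)" where
  "slice i \<rho> = (\<lambda>x. \<rho> (i, x))"

lemma slice_upd: "slice i (\<rho>((j, x) \<mapsto> b)) = (if i = j then (slice i \<rho>)(x \<mapsto> b) else slice i \<rho>)"
  by (auto simp: slice_def fun_eq_iff)

text \<open>In a conjunction every copy must stay able to become true, even when its budget is
  exhausted, and \<open>hard f 0\<close> promises nothing. For h at least 2 the strategy for f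
  leaves a positive budget and hence both values; for h at most 1 the answer follows a fixed
  satisfying assignment.\<close>

lemma hard_answer_True:
  assumes "hard f h \<rho>" "\<exists>\<alpha>. extends \<alpha> \<rho> \<and> f \<alpha>" "\<rho> x = None"
  shows "\<exists>b. hard f (h - 1) (\<rho>(x \<mapsto> b)) \<and> (\<exists>\<alpha>. extends \<alpha> (\<rho>(x \<mapsto> b)) \<and> f \<alpha>)"
proof (cases "h \<le> 1")
  case True
  obtain \<alpha> where "extends \<alpha> \<rho>" "f \<alpha>" using assms(2) by blast
  then have "extends \<alpha> (\<rho>(x \<mapsto> \<alpha> x))" by (auto simp: extends_def)
  then show ?thesis using \<open>f \<alpha>\<close> True by auto
next
  case False
  then obtain g where g: "h = Suc (Suc g)" by (metis One_nat_def le_Suc_eq le_zero_eq not0_implies_Suc)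
  then obtain b where "hard f (Suc g) (\<rho>(x \<mapsto> b))" using assms(1,3) by (metis hard.simps(2))
  then show ?thesis using g by (intro exI[of _ b]) auto
qed

text \<open>Each copy keeps its own budget \<open>h i\<close> and stays satisfiable. As long as some
  budget is positive, the other copies can be made true, and the copy with that budget decides the
  conjunction either way. A query lowers only the budget of its own copy, so the budgets add
  up.\<close>

lemma hard_all_copies:
  "(\<And>i. i < n \<Longrightarrow> hard f (h i) (slice i \<rho>) \<and> (\<exists>\<alpha>. extends \<alpha> (slice i \<rho>) \<and> f \<alpha>)) \<Longrightarrow>
    d \<le> (\<Sum>i<n. h i) \<Longrightarrow> hard (all_copies n f) d \<rho>"
proof (induction d arbitrary: h \<rho>)
  case (Suc d)
  note prems = Suc.prems
  obtain j where j: "j < n" "0 < h j"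
    using prems(2) by (metis (no_types, lifting) gr0I lessThan_iff not_less_eq_eq sum.neutral zero_le)
  obtain a where a: "\<And>i. i < n \<Longrightarrow> extends (a i) (slice i \<rho>) \<and> f (a i)" using prems(1) by metis
  obtain z where z: "extends z (slice j \<rho>)" "\<not> f z"
    using hard_value[of f "h j" "slice j \<rho>" False] prems(1)[OF j(1)] j(2) by auto
  define glue where
    "glue g = (\<lambda>(i, x). if i < n then g i x else \<rho> (i, x) = Some True)" for g :: "nat \<Rightarrow> 'a \<Rightarrow> bool"
  have glue: "extends (glue g) \<rho>" "all_copies n f (glue g) = (\<forall>i<n. f (g i))"
    if "\<And>i. i < n \<Longrightarrow> extends (g i) (slice i \<rho>)" for g
    using that unfolding glue_def extends_def slice_def all_copies_def by auto
  have "extends (glue a) \<rho> \<and> all_copies n f (glue a)" using glue[of a] a by blast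
  moreover have "extends (glue (a(j := z))) \<rho> \<and> \<not> all_copies n f (glue (a(j := z)))"
    using glue[of "a(j := z)"] a z j by auto
  moreover have "\<exists>b. hard (all_copies n f) d (\<rho>(p \<mapsto> b))" if none: "\<rho> p = None" for p
  proof -
    obtain i x where p: "p = (i, x)" by fastforce
    show ?thesis
    proof (cases "i < n \<and> 0 < h i")
      case True
      then obtain b where b: "hard f (h i - 1) ((slice i \<rho>)(x \<mapsto> b))"
        "\<exists>\<alpha>. extends \<alpha> ((slice i \<rho>)(x \<mapsto> b)) \<and> f \<alpha>"
        using hard_answer_True[of f "h i" "slice i \<rho>" x] prems(1) none p
        by (auto simp: slice_def)
      have "(\<Sum>k<n. h k) = h i + (\<Sum>k\<in>{..<n} - {i}. h k)"
        using True by (intro sum.remove) auto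
      moreover have "(\<Sum>k<n. (h(i := h i - 1)) k) = h i - 1 + (\<Sum>k\<in>{..<n} - {i}. h k)"
        using True by (subst sum.remove[of _ i]) auto
      ultimately have "d \<le> (\<Sum>k<n. (h(i := h i - 1)) k)" using prems(2) True by simp
      moreover have "hard f ((h(i := h i - 1)) k) (slice k (\<rho>((i, x) \<mapsto> b))) \<and>
          (\<exists>\<alpha>. extends \<alpha> (slice k (\<rho>((i, x) \<mapsto> b))) \<and> f \<alpha>)" if "k < n" for k
        unfolding slice_upd using b prems(1)[OF that] by (cases "k = i") simp_all
      ultimately have "hard (all_copies n f) d (\<rho>((i, x) \<mapsto> b))" by (rule Suc.IH[rotated])
      then show ?thesis using p by blast
    next
      case False
      \<comment> \<open>A query to an exhausted copy, or to an index beyond n, lowers no budget, so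
        their sum still covers d.\<close>
      have *: "\<exists>b. \<forall>k<n. hard f (h k) (slice k (\<rho>(p \<mapsto> b))) \<and> 
          (\<exists>\<alpha>. extends \<alpha> (slice k (\<rho>(p \<mapsto> b))) \<and> f \<alpha>)"
      proof (cases "i < n")
        case True
        then obtain b where "hard f (h i - 1) ((slice i \<rho>)(x \<mapsto> b))"
          "\<exists>\<alpha>. extends \<alpha> ((slice i \<rho>)(x \<mapsto> b)) \<and> f \<alpha>"
          using hard_answer_True[of f "h i" "slice i \<rho>" x] prems(1) none p
          by (auto simp: slice_def)
        then show ?thesis using False True prems(1) p by (intro exI[of _ b]) (auto simp add: slice_upd simp del: fun_upd_apply)
      next
        case False
        then show ?thesis using prems(1) p by (auto simp: slice_upd)
      qed
      then show ?thesis using Suc.IH[of h] prems(2) by (meson Suc_leD)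
    qed
  qed
  ultimately show ?case by auto
qed simp

text \<open>An ordinary certificate exhibits any one false copy, but that choice is ambiguous. The
  unambiguous one scans the copies in order up to the first false one, and so also opens the true
  copies before it; this is the origin of \<open>n * u True + u False\<close>.\<close>

lemma complexity_bounds_all_copies:
  assumes "complexity_bounds f V d c u"
  shows "complexity_bounds (all_copies n f) ({..<n} \<times> V) (n * d)
    (\<lambda>b. if b then n * c True else c False)
    (\<lambda>b. if b then n * u True else n * u True + u False)"
proof -
  let ?r = "\<lambda>\<alpha> i x. \<alpha> (i, x)"
  have fin: "finite V" and hard: "hard f d Map.empty"
    using assms(1) unfolding complexity_bounds_def by auto
  obtain S where S: "\<And>\<alpha>. S \<alpha> \<subseteq> V" "\<And>\<alpha>. card (S \<alpha>) \<le> c (f \<alpha>)" "\<And>\<alpha>. certifies f (S \<alpha>) \<alpha>"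
    using assms(1) unfolding complexity_bounds_def by metis
  obtain U where U: "unambiguous f U" "\<And>\<alpha>. U \<alpha> \<subseteq> V" "\<And>\<alpha>. card (U \<alpha>) \<le> u (f \<alpha>)"
    using assms(1) unfolding complexity_bounds_def by metis
  have finU: "finite (U \<alpha>)" "finite (S \<alpha>)" for \<alpha> using fin S U finite_subset by metis+
  have h: "hard (all_copies n f) (n * d) Map.empty"
  proof (cases "d = 0")
    case False
    have "slice i (Map.empty :: nat \<times> 'a \<rightharpoonup> bool) = Map.empty" for i by (simp add: slice_def fun_eq_iff)
    then show ?thesis
      using hard hard_value[OF hard, of True] False
      by (intro hard_all_copies[of n f "\<lambda>_. d" Map.empty]) auto
  qed simp
  have sl: "agree X (?r \<alpha> i) (?r \<beta> i)" if "agree Y \<alpha> \<beta>" "{i} \<times> X \<subseteq> Y" for X Y \<alpha> \<beta> i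
    using that unfolding agree_def by auto
  have C: "\<exists>T\<subseteq>{..<n} \<times> V. card T \<le> (if all_copies n f \<alpha> then n * c True else c False) \<and>
      certifies (all_copies n f) T \<alpha>" for \<alpha>
  proof (cases "all_copies n f \<alpha>")
    case True
    define T where "T = Sigma {..<n} (\<lambda>i. S (?r \<alpha> i))"
    have "card T = (\<Sum>i<n. card (S (?r \<alpha> i)))" unfolding T_def using finU by simp
    also have "\<dots> \<le> (\<Sum>i<n. c True)"
      using True S(2)[of "?r \<alpha> _"] unfolding all_copies_def by (intro sum_mono) (metis lessThan_iff)
    finally have "card T \<le> n * c True" by simp
    moreover have "certifies (all_copies n f) T \<alpha>"
      unfolding certifies_def
    proof (intro allI impI)
      fix \<beta> assume ag: "agree T \<alpha> \<beta>"
      have "f (?r \<beta> i) = f (?r \<alpha> i)" if "i < n" for i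
        using S(3) sl[OF ag, of i "S (?r \<alpha> i)"] that unfolding certifies_def T_def by auto
      then show "all_copies n f \<beta> = all_copies n f \<alpha>" unfolding all_copies_def by auto
    qed
    moreover have "T \<subseteq> {..<n} \<times> V" unfolding T_def using S(1) by blast
    ultimately show ?thesis using True by auto
  next
    case False
    then obtain i where i: "i < n" "\<not> f (?r \<alpha> i)" unfolding all_copies_def by auto
    define T where "T = {i} \<times> S (?r \<alpha> i)"
    have "card T \<le> c False" using S(2)[of "?r \<alpha> i"] i unfolding T_def by (simp add: card_cartesian_product)
    moreover have "certifies (all_copies n f) T \<alpha>"
      unfolding certifies_def
    proof (intro allI impI)
      fix \<beta> assume "agree T \<alpha> \<beta>"
      then have "agree (S (?r \<alpha> i)) (?r \<alpha> i) (?r \<beta> i)" by (rule sl) (simp add: T_def)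
      then have "\<not> f (?r \<beta> i)" using S(3) i(2) unfolding certifies_def by metis
      then show "all_copies n f \<beta> = all_copies n f \<alpha>" using False i unfolding all_copies_def by auto
    qed
    moreover have "T \<subseteq> {..<n} \<times> V" unfolding T_def using S(1) i by blast
    ultimately show ?thesis using False by auto
  qed
  define I where "I \<alpha> = {i. i < n \<and> (\<forall>j<i. f (?r \<alpha> j))}" for \<alpha>
  define W where "W \<alpha> = Sigma (I \<alpha>) (\<lambda>i. U (?r \<alpha> i))" for \<alpha>
  have finI: "finite (I \<alpha>)" for \<alpha> unfolding I_def by simp
  have cardW: "card (W \<alpha>) = (\<Sum>i\<in>I \<alpha>. card (U (?r \<alpha> i)))" for \<alpha>
    unfolding W_def using finI finU by simp
  have "unambiguous (all_copies n f) W"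
    unfolding unambiguous_def
  proof (intro allI impI)
    fix \<alpha> \<beta> assume ag: "agree (W \<alpha>) \<alpha> \<beta>"
    have eq: "f (?r \<beta> i) = f (?r \<alpha> i) \<and> U (?r \<beta> i) = U (?r \<alpha> i)" if "i \<in> I \<alpha>" for i
      using U(1) sl[OF ag, of i "U (?r \<alpha> i)"] that unfolding unambiguous_def W_def by blast
    have pre: "(\<forall>j<i. f (?r \<beta> j)) = (\<forall>j<i. f (?r \<alpha> j))" if "i \<le> n" for i
      using that
    proof (induction i)
      case (Suc i)
      then show ?case using eq[of i] unfolding I_def by (auto simp: less_Suc_eq)
    qed simp
    then have "I \<beta> = I \<alpha>" unfolding I_def by (intro Collect_cong) (use less_imp_le in blast)
    then have "W \<beta> = W \<alpha>" using eq unfolding W_def by auto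
    then show "all_copies n f \<beta> = all_copies n f \<alpha> \<and> W \<beta> = W \<alpha>"
      using pre[of n] unfolding all_copies_def by auto
  qed
  moreover have "W \<alpha> \<subseteq> {..<n} \<times> V" for \<alpha> using U(2) unfolding W_def I_def by blast
  moreover have "card (W \<alpha>) \<le> (if all_copies n f \<alpha> then n * u True else n * u True + u False)" for \<alpha>
  proof (cases "all_copies n f \<alpha>")
    case True
    then have "card (U (?r \<alpha> i)) \<le> u True" if "i \<in> I \<alpha>" for i
      using U(3)[of "?r \<alpha> i"] that unfolding I_def all_copies_def by auto
    then have "card (W \<alpha>) \<le> card (I \<alpha>) * u True"
      unfolding cardW by (rule sum_bounded_above[of "I \<alpha>" _ "u True", simplified])
    moreover have "card (I \<alpha>) \<le> card {..<n}" unfolding I_def by (intro card_mono) auto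
    ultimately show ?thesis using True by (simp add: le_trans)
  next
    case False
    define k where "k = (LEAST i. \<not> f (?r \<alpha> i))"
    obtain i0 where i0: "i0 < n" "\<not> f (?r \<alpha> i0)" using False unfolding all_copies_def by auto
    have k1: "\<not> f (?r \<alpha> k)" unfolding k_def by (rule LeastI, rule i0(2))
    have k2: "k < n" using Least_le[of "\<lambda>i. \<not> f (?r \<alpha> i)", OF i0(2)] i0(1) unfolding k_def by linarith
    have k3: "f (?r \<alpha> j)" if "j < k" for j
      using not_less_Least[of j "\<lambda>i. \<not> f (?r \<alpha> i)"] that unfolding k_def by blast
    have mem: "i \<in> I \<alpha> \<longleftrightarrow> i \<le> k" for i
    proof
      assume "i \<in> I \<alpha>"
      then show "i \<le> k" using k1 unfolding I_def by (cases "k < i") auto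
    next
      assume "i \<le> k"
      then show "i \<in> I \<alpha>" using k2 k3 unfolding I_def by auto
    qed
    have I: "I \<alpha> = insert k {..<k}"
      unfolding set_eq_iff insert_iff lessThan_iff mem by (simp only: le_less) blast
    have "card (W \<alpha>) = card (U (?r \<alpha> k)) + (\<Sum>i<k. card (U (?r \<alpha> i)))"
      unfolding cardW I by (rule sum.insert) simp_all
    also have "\<dots> \<le> u False + (\<Sum>i<k. u True)"
    proof (intro add_mono sum_mono)
      show "card (U (?r \<alpha> k)) \<le> u False" using U(3)[of "?r \<alpha> k"] k1 by simp
      show "card (U (?r \<alpha> i)) \<le> u True" if "i \<in> {..<k}" for i
        using U(3)[of "?r \<alpha> i"] k3[of i] that by simp
    qed
    also have "\<dots> \<le> n * u True + u False" using k2 by simp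
    finally show ?thesis using False by simp
  qed
  ultimately show ?thesis
    unfolding complexity_bounds_def using fin h C by blast
qed

section \<open>Cheat sheets\<close>

text \<open>\<open>Inl (i, x)\<close> is the variable x of the i-th input.
  \<open>Inr (l, i, t)\<close> is bit t of the entry for input i in the cell with address l.\<close>

type_synonym 'v sheet_var = "nat \<times> 'v + bool list \<times> nat \<times> nat"

definition address :: "nat \<Rightarrow> (('v \<Rightarrow> bool) \<Rightarrow> bool) \<Rightarrow> ('v sheet_var \<Rightarrow> bool) \<Rightarrow> bool list" where
  "address \<kappa> f \<alpha> = map (\<lambda>i. f (\<lambda>x. \<alpha> (Inl (i, x)))) [0..<\<kappa>]"

definition cell :: "nat \<Rightarrow> ('v sheet_var \<Rightarrow> bool) \<Rightarrow> bool list \<Rightarrow> nat \<Rightarrow> bool list" where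
  "cell T \<alpha> l i = map (\<lambda>t. \<alpha> (Inr (l, i, t))) [0..<T]"

text \<open>The values of \<open>\<kappa>\<close> independent inputs of \<open>f\<close> address the one cell, out of \<open>2\<^sup>\<kappa>\<close>, that must
  describe certificates for these values.\<close>

definition cheat_sheet :: "nat \<Rightarrow> nat \<Rightarrow> (bool list \<Rightarrow> 'v set) \<Rightarrow> (('v \<Rightarrow> bool) \<Rightarrow> bool) \<Rightarrow>
    ('v sheet_var \<Rightarrow> bool) \<Rightarrow> bool" where
  "cheat_sheet \<kappa> T dec f \<alpha> \<longleftrightarrow>
     (\<forall>i<\<kappa>. certifies f (dec (cell T \<alpha> (address \<kappa> f \<alpha>) i)) (\<lambda>x. \<alpha> (Inl (i, x))))"

definition input_slice :: "nat \<Rightarrow> ('v sheet_var \<rightharpoonup> bool) \<Rightarrow> ('v \<rightharpoonup> bool)" where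
  "input_slice i \<rho> = (\<lambda>x. \<rho> (Inl (i, x)))"

definition touched :: "('v sheet_var \<rightharpoonup> bool) \<Rightarrow> bool list set" where
  "touched \<rho> = {l. \<exists>i t. \<rho> (Inr (l, i, t)) \<noteq> None}"

lemma card_bool_lists: "card {l :: bool list. length l = n} = 2 ^ n" 
  and finite_bool_lists: "finite {l :: bool list. length l = n}"
  using card_lists_length_eq[of "UNIV :: bool set" n] finite_lists_length_eq[of "UNIV :: bool set" n]
  by simp_all

text \<open>Queries to the inputs follow the strategy for f, and queries to cells are answered
  arbitrarily. Fewer than \<open>2 ^ \<kappa>\<close> cells are touched while d is positive, and the
  inputs can still take any values, so they can be steered to an untouched address. Filling that
  cell with correct certificates makes the function true; filling it with descriptions of the empty
  set makes it false, because f is not constant.\<close>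

lemma hard_cheat_sheet:
  assumes "0 < \<kappa>"
    and empty: "length e = T" "dec e = {}"
    and certs: "\<And>\<alpha>. \<exists>l. length l = T \<and> certifies f (dec l) \<alpha>"
  shows "(\<And>i. i < \<kappa> \<Longrightarrow> hard f d (input_slice i \<rho>)) \<Longrightarrow> finite (touched \<rho>) \<Longrightarrow>
    card (touched \<rho>) + d \<le> 2 ^ \<kappa> \<Longrightarrow> hard (cheat_sheet \<kappa> T dec f) d \<rho>"
proof (induction d arbitrary: \<rho>)
  case (Suc d)
  note prems = Suc.prems
  have "\<exists>l. length l = \<kappa> \<and> l \<notin> touched \<rho>"
  proof (rule ccontr)
    assume "\<not> ?thesis"
    then have "{l. length l = \<kappa>} \<subseteq> touched \<rho>" by blast
    then show False using card_mono[OF prems(2), of "{l. length l = \<kappa>}"] prems(3)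
      by (simp add: card_bool_lists)
  qed
  then obtain l where l: "length l = \<kappa>" "l \<notin> touched \<rho>" by blast
  have "\<exists>\<alpha>. extends \<alpha> (input_slice i \<rho>) \<and> f \<alpha> = l ! i" if "i < \<kappa>" for i
    using hard_value[OF prems(1)[OF that]] by blast
  then obtain a where a: "\<And>i. i < \<kappa> \<Longrightarrow> extends (a i) (input_slice i \<rho>)" "\<And>i. i < \<kappa> \<Longrightarrow> f (a i) = l ! i"
    by metis
  obtain s where s: "\<And>\<alpha>. length (s \<alpha>) = T" "\<And>\<alpha>. certifies f (dec (s \<alpha>)) \<alpha>" using certs by metis
  define glue where "glue g v = (case v of
      Inl (i, x) \<Rightarrow> if i < \<kappa> then a i x else \<rho> v = Some True
    | Inr (k, i, t) \<Rightarrow> if k = l then g i ! t else \<rho> v = Some True)" for g :: "nat \<Rightarrow> bool list" and v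
  have ext: "extends (glue g) \<rho>" for g
    using a(1) l(2) unfolding glue_def extends_def input_slice_def touched_def
    by (auto split: sum.splits prod.splits)
  have inp: "(\<lambda>x. glue g (Inl (i, x))) = a i" if "i < \<kappa>" for g i
    using that by (simp add: glue_def)
  have addr: "address \<kappa> f (glue g) = l" for g
    unfolding address_def using inp a(2) l(1) by (intro nth_equalityI) auto
  have blk: "cell T (glue g) l i = g i" if "length (g i) = T" for g i
    unfolding cell_def using that by (intro nth_equalityI) (auto simp: glue_def)
  have "cheat_sheet \<kappa> T dec f (glue (\<lambda>i. s (a i)))"
    unfolding cheat_sheet_def addr using s by (simp add: blk inp)
  moreover have "\<not> cheat_sheet \<kappa> T dec f (glue (\<lambda>i. e))"
  proof
    assume "cheat_sheet \<kappa> T dec f (glue (\<lambda>i. e))"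
    then have "certifies f {} (a 0)"
      unfolding cheat_sheet_def addr using assms(1) empty by (auto simp: blk inp)
    then have "f \<beta> = f (a 0)" for \<beta> unfolding certifies_def agree_def by blast
    then show False using hard_value[OF prems(1)[OF assms(1)]] by (metis zero_less_Suc)
  qed
  moreover have "\<exists>b. hard (cheat_sheet \<kappa> T dec f) d (\<rho>(v \<mapsto> b))" if none: "\<rho> v = None" for v
  proof (cases v)
    case (Inl p)
    obtain j x where p: "p = (j, x)" by fastforce
    have sl: "input_slice i (\<rho>(v \<mapsto> b)) =
        (if i = j then (input_slice i \<rho>)(x \<mapsto> b) else input_slice i \<rho>)" for i b
      using Inl p by (auto simp: input_slice_def fun_eq_iff)
    have t: "touched (\<rho>(v \<mapsto> b)) = touched \<rho>" for b using Inl by (simp add: touched_def)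
    have "\<exists>b. j < \<kappa> \<longrightarrow> hard f d ((input_slice j \<rho>)(x \<mapsto> b))"
      using prems(1)[of j] none Inl p by (auto simp: input_slice_def)
    then obtain b where "j < \<kappa> \<longrightarrow> hard f d ((input_slice j \<rho>)(x \<mapsto> b))" by blast
    then have "hard (cheat_sheet \<kappa> T dec f) d (\<rho>(v \<mapsto> b))"
      using prems hard_Suc_imp[OF prems(1)] by (intro Suc.IH; unfold sl t) simp_all
    then show ?thesis by blast
  next
    case (Inr q)
    obtain k i t where q: "q = (k, i, t)" by (metis prod.exhaust)
    have sl: "input_slice i (\<rho>(v \<mapsto> b)) = input_slice i \<rho>" for i b
      using Inr by (simp add: input_slice_def)
    have t: "touched (\<rho>(v \<mapsto> b)) \<subseteq> insert k (touched \<rho>)" for b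
      using Inr q by (auto simp: touched_def split: if_splits)
    have "card (touched (\<rho>(v \<mapsto> b))) \<le> card (insert k (touched \<rho>))" for b
      using t prems(2) by (intro card_mono) auto
    also have "\<dots> \<le> Suc (card (touched \<rho>))" using prems(2) by (simp add: card_insert_if)
    finally have c: "card (touched (\<rho>(v \<mapsto> b))) \<le> Suc (card (touched \<rho>))" for b .
    have "finite (touched (\<rho>(v \<mapsto> b)))" for b
      using t prems(2) finite_subset by blast
    moreover have "hard f d (input_slice i (\<rho>(v \<mapsto> True)))" if "i < \<kappa>" for i
      unfolding sl using hard_Suc_imp[OF prems(1)[OF that]] .
    moreover have "card (touched (\<rho>(v \<mapsto> True))) + d \<le> 2 ^ \<kappa>"
      using prems(3) c[of True] by linarith
    ultimately have "hard (cheat_sheet \<kappa> T dec f) d (\<rho>(v \<mapsto> True))" by (intro Suc.IH)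
    then show ?thesis by blast
  qed
  ultimately show ?case using ext by auto
qed simp

section \<open>Encoding small sets of variables by bit strings\<close>

lemma card_small_subsets:
  assumes "finite V"
  shows "card {S. S \<subseteq> V \<and> card S \<le> c} \<le> (card V + 1) ^ c"
proof (induction c)
  case 0
  have "{S. S \<subseteq> V \<and> card S \<le> 0} = {{}}"
    using assms finite_subset[of _ V] by (auto simp del: card_0_eq simp: card_eq_0_iff)
  then show ?case by simp
next
  case (Suc c)
  let ?P = "\<lambda>c. {S. S \<subseteq> V \<and> card S \<le> c}"
  have fin: "finite (?P c)" for c using assms by auto
  \<comment> \<open>A set of size at most c arises from c choices, each an element of V or nothing;
    hence the base \<open>card V + 1\<close>.\<close>
  define add where "add = (\<lambda>(x, S). case x of None \<Rightarrow> S | Some y \<Rightarrow> insert (y :: 'a) S)"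
  have "?P (Suc c) \<subseteq> add ` (insert None (Some ` V) \<times> ?P c)"
  proof
    fix S assume S: "S \<in> ?P (Suc c)"
    show "S \<in> add ` (insert None (Some ` V) \<times> ?P c)"
    proof (cases "card S \<le> c")
      case True
      then have "S = add (None, S)" "(None, S) \<in> insert None (Some ` V) \<times> ?P c"
        using S by (auto simp: add_def)
      then show ?thesis by blast
    next
      case False
      then obtain y where y: "y \<in> S" by fastforce
      have "finite S" using S assms finite_subset by blast
      then have "S = add (Some y, S - {y})" "(Some y, S - {y}) \<in> insert None (Some ` V) \<times> ?P c"
        using S y False by (auto simp: add_def)
      then show ?thesis by blast
    qed
  qed
  then have "card (?P (Suc c)) \<le> card (insert None (Some ` V) \<times> ?P c)"
    using fin assms by (intro surj_card_le) auto
  also have "\<dots> = (card V + 1) * card (?P c)"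
    using assms by (simp add: card_cartesian_product card_image)
  also have "\<dots> \<le> (card V + 1) ^ Suc c" unfolding power_Suc using Suc.IH by (rule mult_le_mono2)
  finally show ?case .
qed

text \<open>Strings that encode nothing decode to the empty set. Thus even a cell with meaningless
  content names only a small set, which bounds the certificates for the value false as well.\<close>

lemma decoder_exists:
  assumes "finite V" "(card V + 1) ^ c \<le> 2 ^ T"
  shows "\<exists>dec :: bool list \<Rightarrow> 'v set. (\<forall>l. dec l \<subseteq> V \<and> card (dec l) \<le> c) \<and>
    (\<forall>S\<subseteq>V. card S \<le> c \<longrightarrow> (\<exists>l. length l = T \<and> dec l = S))"
proof -
  let ?P = "{S. S \<subseteq> V \<and> card S \<le> c}"
  have "card ?P \<le> card {l :: bool list. length l = T}"
    using card_small_subsets[OF assms(1), of c] assms(2) by (simp add: card_bool_lists)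
  then obtain g where g: "inj_on g ?P" "g ` ?P \<subseteq> {l :: bool list. length l = T}"
    using card_le_inj[of ?P "{l :: bool list. length l = T}"] assms(1) finite_bool_lists by auto
  define dec where "dec l = (if l \<in> g ` ?P then inv_into ?P g l else {})" for l
  have "dec l \<in> ?P" for l
    unfolding dec_def using inv_into_into[of l g ?P] by auto
  moreover have "length (g S) = T \<and> dec (g S) = S" if "S \<in> ?P" for S
    using that g inv_into_f_f[OF g(1) that] unfolding dec_def by auto
  ultimately show ?thesis by (intro exI[of _ dec]) blast
qed

text \<open>If the function is true, the sets named in the addressed cell certify the values of the
  inputs, and these values form the address: the cell vouches for its own selection, and u does not
  enter. If it is false, the named sets may prove nothing, so unambiguous certificates of the inputs
  have to pin down the address.\<close>

lemma complexity_bounds_cheat_sheet: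
  assumes f: "complexity_bounds f V d (\<lambda>_. c) (\<lambda>_. u)"
    and T: "(card V + 1) ^ c \<le> 2 ^ T" and \<kappa>: "0 < \<kappa>" "d \<le> 2 ^ \<kappa>"
  shows "\<exists>dec. complexity_bounds (cheat_sheet \<kappa> T dec f)
    (Inl ` ({..<\<kappa>} \<times> V) \<union> Inr ` ({l. length l = \<kappa>} \<times> {..<\<kappa>} \<times> {..<T})) d
    (\<lambda>_. \<kappa> * (c + c + T)) (\<lambda>b. if b then \<kappa> * (c + T) else \<kappa> * (u + c + T))"
proof -
  let ?r = "\<lambda>\<alpha> i x. \<alpha> (Inl (i, x))"
  have fin: "finite V" and hard: "hard f d Map.empty"
    using f unfolding complexity_bounds_def by auto
  obtain S where S: "\<And>\<alpha>. S \<alpha> \<subseteq> V" "\<And>\<alpha>. card (S \<alpha>) \<le> c" "\<And>\<alpha>. certifies f (S \<alpha>) \<alpha>"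
    using f unfolding complexity_bounds_def by metis
  obtain U where U: "unambiguous f U" "\<And>\<alpha>. U \<alpha> \<subseteq> V" "\<And>\<alpha>. card (U \<alpha>) \<le> u"
    using f unfolding complexity_bounds_def by metis
  obtain dec :: "bool list \<Rightarrow> 'a set" where dec: "\<And>l. dec l \<subseteq> V" "\<And>l. card (dec l) \<le> c"
    "\<And>X. X \<subseteq> V \<Longrightarrow> card X \<le> c \<Longrightarrow> \<exists>l. length l = T \<and> dec l = X"
    using decoder_exists[OF fin T] by metis
  define cs where "cs = cheat_sheet \<kappa> T dec f"
  define W where "W = Inl ` ({..<\<kappa>} \<times> V) \<union> Inr ` ({l :: bool list. length l = \<kappa>} \<times> {..<\<kappa>} \<times> {..<T})"
  define D where "D \<alpha> i = dec (cell T \<alpha> (address \<kappa> f \<alpha>) i)" for \<alpha> i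
  \<comment> \<open>X supplies what fixes the values of the inputs: S for ordinary certificates, U
    for unambiguous ones of the value false, and nothing for the value true. The addressed cell and
    the sets that it names are read in all three cases.\<close>
  define Q where "Q X \<alpha> = (\<Union>i<\<kappa>. (\<lambda>x. Inl (i, x)) ` (X (?r \<alpha> i) \<union> D \<alpha> i)
      \<union> (\<lambda>t. Inr (address \<kappa> f \<alpha>, i, t)) ` {..<T})" for X \<alpha>
  have finW: "finite W" unfolding W_def using fin finite_bool_lists by simp
  have QW: "Q X \<alpha> \<subseteq> W" if "\<And>\<alpha>. X \<alpha> \<subseteq> V" for X \<alpha>
    using subsetD[OF that] subsetD[OF dec(1)] unfolding Q_def W_def D_def
    by (auto simp: address_def image_iff)
  have cardQ: "card (Q X \<alpha>) \<le> \<kappa> * (w + c + T)" if "\<And>i. card (X (?r \<alpha> i)) \<le> w" for X \<alpha> w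
  proof -
    have "card (Q X \<alpha>) \<le> (\<Sum>i<\<kappa>. card ((\<lambda>x. Inl (i, x)) ` (X (?r \<alpha> i) \<union> D \<alpha> i)
      \<union> (\<lambda>t. Inr (address \<kappa> f \<alpha>, i, t)) ` {..<T}))"
      unfolding Q_def by (rule card_UN_le) simp
    also have "\<dots> \<le> (\<Sum>i<\<kappa>. w + c + T)"
    proof (rule sum_mono)
      fix i
      have "card ((\<lambda>x. Inl (i, x) :: 'a sheet_var) ` (X (?r \<alpha> i) \<union> D \<alpha> i)) = card (X (?r \<alpha> i) \<union> D \<alpha> i)"
        by (intro card_image inj_onI) simp
      also have "\<dots> \<le> w + c"
        using card_Un_le[of "X (?r \<alpha> i)" "D \<alpha> i"] that[of i] dec(2) unfolding D_def
        by (meson add_mono le_trans)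
      finally have "card ((\<lambda>x. Inl (i, x) :: 'a sheet_var) ` (X (?r \<alpha> i) \<union> D \<alpha> i)) \<le> w + c" .
      moreover have "card ((\<lambda>t. Inr (address \<kappa> f \<alpha>, i, t) :: 'a sheet_var) ` {..<T}) \<le> T"
        using card_image_le[of "{..<T}"] by fastforce
      ultimately show "card ((\<lambda>x. Inl (i, x)) ` (X (?r \<alpha> i) \<union> D \<alpha> i)
          \<union> (\<lambda>t. Inr (address \<kappa> f \<alpha>, i, t)) ` {..<T}) \<le> w + c + T"
        by (meson add_mono card_Un_le le_trans)
    qed
    finally show ?thesis by simp
  qed
  have memQ: "Inl (i, x) \<in> Q X \<alpha> \<longleftrightarrow> i < \<kappa> \<and> (x \<in> X (?r \<alpha> i) \<or> x \<in> D \<alpha> i)" for i x X \<alpha>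
    unfolding Q_def by auto
  have memQ': "Inr (l, i, t) \<in> Q X \<alpha> \<longleftrightarrow> l = address \<kappa> f \<alpha> \<and> i < \<kappa> \<and> t < T" for l i t X \<alpha>
    unfolding Q_def by auto
  have sub: "agree (X (?r \<alpha> i)) (?r \<alpha> i) (?r \<beta> i)" "agree (D \<alpha> i) (?r \<alpha> i) (?r \<beta> i)"
    if "agree (Q X \<alpha>) \<alpha> \<beta>" "i < \<kappa>" for X \<alpha> \<beta> i
    using that memQ[of i _ X \<alpha>] unfolding agree_def by blast+
  text \<open>Once the values of the inputs are known, agreement on the addressed cell and on the sets
    it describes determines the value of the cheat sheet function.\<close>
  have same: "address \<kappa> f \<beta> = address \<kappa> f \<alpha> \<and> (\<forall>i<\<kappa>. D \<beta> i = D \<alpha> i) \<and> cs \<beta> = cs \<alpha>"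
    if ag: "agree (Q X \<alpha>) \<alpha> \<beta>" and val: "\<And>i. i < \<kappa> \<Longrightarrow> f (?r \<beta> i) = f (?r \<alpha> i)" for X \<alpha> \<beta>
  proof -
    have addr: "address \<kappa> f \<beta> = address \<kappa> f \<alpha>" using val by (simp add: address_def)
    have "cell T \<beta> (address \<kappa> f \<alpha>) i = cell T \<alpha> (address \<kappa> f \<alpha>) i" if "i < \<kappa>" for i
      unfolding cell_def using that agreeD[OF ag, symmetric] by (intro map_cong refl) (simp add: memQ')
    then have D: "D \<beta> i = D \<alpha> i" if "i < \<kappa>" for i using that addr by (simp add: D_def)
    have "certifies f (D \<alpha> i) (?r \<beta> i) = certifies f (D \<alpha> i) (?r \<alpha> i)" if "i < \<kappa>" for i
      using certifies_agree[OF sub(2)[OF ag that] val[OF that, symmetric]] by blast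
    then have "cs \<beta> = cs \<alpha>" using D unfolding cs_def cheat_sheet_def D_def by auto
    then show ?thesis using addr D by blast
  qed
  have "hard cs d Map.empty"
    unfolding cs_def
  proof -
    obtain e where e: "length e = T" "dec e = {}" using dec(3)[of "{}"] by auto
    have "\<exists>l. length l = T \<and> certifies f (dec l) \<alpha>" for \<alpha>
      using dec(3)[OF S(1,2)] S(3) by metis
    then show "hard (cheat_sheet \<kappa> T dec f) d Map.empty"
      using hard \<kappa> by (intro hard_cheat_sheet[of \<kappa> e T dec f, OF \<kappa>(1) e]) (auto simp: input_slice_def touched_def)
  qed
  moreover have "\<exists>X\<subseteq>W. card X \<le> \<kappa> * (c + c + T) \<and> certifies cs X \<alpha>" for \<alpha>
  proof -
    have "certifies cs (Q S \<alpha>) \<alpha>"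
      unfolding certifies_def using same[of S \<alpha>] sub(1)[of S \<alpha>] S(3) unfolding certifies_def by blast
    then show ?thesis using QW[of S \<alpha>, OF S(1)] cardQ[of S \<alpha> c, OF S(2)] by blast
  qed
  \<comment> \<open>Splitting on the value of \<open>cs\<close> keeps R unambiguous: in either case
    agreement on R fixes the values of the inputs, and \<open>same\<close> then fixes
    \<open>cs\<close>.\<close>
  moreover define R where "R \<alpha> = Q (if cs \<alpha> then (\<lambda>_. {}) else U) \<alpha>" for \<alpha>
  have "unambiguous cs R"
    unfolding unambiguous_def
  proof (intro allI impI)
    fix \<alpha> \<beta> assume ag: "agree (R \<alpha>) \<alpha> \<beta>"
    have val: "f (?r \<beta> i) = f (?r \<alpha> i) \<and> (\<not> cs \<alpha> \<longrightarrow> U (?r \<beta> i) = U (?r \<alpha> i))" if i: "i < \<kappa>" for i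
    proof (cases "cs \<alpha>")
      case True
      then have "certifies f (D \<alpha> i) (?r \<alpha> i)"
        using i unfolding cs_def cheat_sheet_def D_def by blast
      then show ?thesis using sub(2)[OF ag[unfolded R_def] i] True unfolding certifies_def by blast
    next
      case False
      then show ?thesis using sub(1)[OF ag[unfolded R_def] i] U(1) unfolding unambiguous_def by simp
    qed
    then have s: "address \<kappa> f \<beta> = address \<kappa> f \<alpha>" "\<forall>i<\<kappa>. D \<beta> i = D \<alpha> i" "cs \<beta> = cs \<alpha>"
      using same[OF ag[unfolded R_def]] by blast+
    then have "R \<beta> = R \<alpha>" using val unfolding R_def Q_def by (cases "cs \<alpha>") auto
    then show "cs \<beta> = cs \<alpha> \<and> R \<beta> = R \<alpha>" using s by blast
  qed
  moreover have "R \<alpha> \<subseteq> W" for \<alpha>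
    unfolding R_def using U(2) by (intro QW) auto
  moreover have "card (R \<alpha>) \<le> (if cs \<alpha> then \<kappa> * (c + T) else \<kappa> * (u + c + T))" for \<alpha>
    using cardQ[of "\<lambda>_. {}" \<alpha> 0] cardQ[of U \<alpha> u] U(3) unfolding R_def by auto
  ultimately have "complexity_bounds cs W d (\<lambda>_. \<kappa> * (c + c + T))
      (\<lambda>b. if b then \<kappa> * (c + T) else \<kappa> * (u + c + T))"
    unfolding complexity_bounds_def using finW by blast
  then show ?thesis unfolding cs_def W_def by blast
qed

section \<open>The lifted hitting formula\<close>

definition blocks :: "nat set \<Rightarrow> nat set" where
  "blocks S = {x. x div 3 \<in> S}"

definition falsified_clause :: "nat set \<Rightarrow> (nat \<Rightarrow> bool) \<Rightarrow> clause" where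
  "falsified_clause S \<alpha> = (\<lambda>x. (x, \<not> \<alpha> x)) ` S"

lemma blocks_eq: "blocks S = (\<lambda>(i, j). 3 * i + j) ` (S \<times> {..<3})"
proof
  show "blocks S \<subseteq> (\<lambda>(i, j). 3 * i + j) ` (S \<times> {..<3})"
  proof
    fix x assume "x \<in> blocks S"
    then have "(x div 3, x mod 3) \<in> S \<times> {..<3}" unfolding blocks_def by simp
    moreover have "x = (\<lambda>(i, j). 3 * i + j) (x div 3, x mod 3)" by simp
    ultimately show "x \<in> (\<lambda>(i, j). 3 * i + j) ` (S \<times> {..<3})" by (rule rev_image_eqI)
  qed
qed (auto simp: blocks_def)

lemma finite_blocks: "finite S \<Longrightarrow> finite (blocks S)"
  unfolding blocks_eq by simp

lemma card_blocks_le: "finite S \<Longrightarrow> card (blocks S) \<le> 3 * card S"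
  unfolding blocks_eq
  using card_image_le[of "S \<times> {..<3}" "\<lambda>(i, j). 3 * i + j"] by (simp add: card_cartesian_product)

lemma blocks_mono: "S \<subseteq> T \<Longrightarrow> blocks S \<subseteq> blocks T"
  unfolding blocks_def by auto

lemma agree_majority:
  assumes "agree (blocks S) \<alpha> \<beta>"
  shows "agree S (majority \<alpha>) (majority \<beta>)"
  unfolding agree_def
proof
  fix i assume "i \<in> S"
  moreover have "(3 * i) div 3 = i" "(3 * i + 1) div 3 = i" "(3 * i + 2) div 3 = i" by presburger+
  ultimately have "3 * i \<in> blocks S" "3 * i + 1 \<in> blocks S" "3 * i + 2 \<in> blocks S"
    unfolding blocks_def mem_Collect_eq by argo+
  then show "majority \<alpha> i = majority \<beta> i"
    using agreeD[OF assms] unfolding majority_def by metis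
qed

lemma falsified_clause_iff: "\<not> sat_clause \<beta> (falsified_clause S \<alpha>) \<longleftrightarrow> agree S \<alpha> \<beta>"
  unfolding sat_clause_def falsified_clause_def agree_def by auto

text \<open>Each clause excludes one subcube of the unambiguous partition, pulled back so that all
  three bits of every fixed block are fixed. The subcubes cover the cube, hence unsatisfiability,
  and are disjoint, hence the hitting property. The base \<open>6 * card V + 1\<close> counts three
  bits per variable with two signs, plus one for an empty slot.\<close>

lemma lifted_formula_exists:
  fixes f :: "(nat \<Rightarrow> bool) \<Rightarrow> bool"
  assumes f: "complexity_bounds f V d c u" and w: "\<And>b. u b \<le> w"
  shows "\<exists>G. hitting_formula G \<and> unsatisfiable G \<and> (\<forall>C\<in>G. width C \<le> 3 * w) \<and>
    card G \<le> (6 * card V + 1) ^ (3 * w) \<and>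
    (\<forall>\<pi>. is_refutation G \<pi> \<and> tree_like \<pi> \<longrightarrow> 2 ^ d \<le> proof_size \<pi>)"
proof -
  have fin: "finite V" and hard: "hard f d Map.empty"
    using f unfolding complexity_bounds_def by auto
  obtain U where U: "unambiguous f U" "\<And>\<alpha>. U \<alpha> \<subseteq> V" "\<And>\<alpha>. card (U \<alpha>) \<le> u (f \<alpha>)"
    using f unfolding complexity_bounds_def by metis
  define B where "B \<alpha> = blocks (U (majority \<alpha>))" for \<alpha>
  define cl where "cl \<alpha> = falsified_clause (B \<alpha>) \<alpha>" for \<alpha>
  define G where "G = range cl"
  have finU: "finite (U \<alpha>)" for \<alpha> using fin U(2) finite_subset by blast
  have finB: "finite (B \<alpha>)" for \<alpha> unfolding B_def using finU finite_blocks by blast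
  have B_eq: "f (majority \<beta>) = f (majority \<alpha>)" "B \<beta> = B \<alpha>" if "agree (B \<alpha>) \<alpha> \<beta>" for \<alpha> \<beta>
    using U(1) agree_majority[OF that[unfolded B_def]] unfolding unambiguous_def B_def by auto
  have wd: "card (cl \<alpha>) \<le> 3 * w" for \<alpha>
  proof -
    have "card (cl \<alpha>) \<le> card (B \<alpha>)"
      unfolding cl_def falsified_clause_def by (rule card_image_le[OF finB])
    also have "\<dots> \<le> 3 * card (U (majority \<alpha>))" unfolding B_def by (rule card_blocks_le[OF finU])
    also have "\<dots> \<le> 3 * w" using order_trans[OF U(3) w] by simp
    finally show ?thesis .
  qed
  let ?L = "blocks V \<times> (UNIV :: bool set)"
  have finL: "finite ?L" using finite_blocks[OF fin] by simp
  have sub: "G \<subseteq> {S. S \<subseteq> ?L \<and> card S \<le> 3 * w}"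
    using wd blocks_mono[OF U(2)] unfolding G_def
    by (fastforce simp: cl_def falsified_clause_def B_def)
  have "card G \<le> card {S. S \<subseteq> ?L \<and> card S \<le> 3 * w}"
    using sub finL by (intro card_mono) auto
  also have "\<dots> \<le> (card ?L + 1) ^ (3 * w)" by (rule card_small_subsets[OF finL])
  also have "\<dots> \<le> (6 * card V + 1) ^ (3 * w)"
    using card_blocks_le[OF fin] by (intro power_mono) (auto simp: card_cartesian_product)
  finally have cardG: "card G \<le> (6 * card V + 1) ^ (3 * w)" .
  have "finite G" using finite_subset[OF sub] finL by simp
  moreover have "is_clause (cl \<alpha>)" for \<alpha>
    unfolding is_clause_def cl_def falsified_clause_def using finB by auto
  ultimately have cnf: "is_cnf G" unfolding is_cnf_def G_def by blast
  have hit: "\<exists>l\<in>cl \<alpha>. complement l \<in> cl \<beta>" if "cl \<alpha> \<noteq> cl \<beta>" for \<alpha> \<beta>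
  proof (rule ccontr)
    assume no: "\<not> ?thesis"
    have same: "\<alpha> x = \<beta> x" if "x \<in> B \<alpha>" "x \<in> B \<beta>" for x
    proof (rule ccontr)
      assume "\<alpha> x \<noteq> \<beta> x"
      then have "(x, \<not> \<alpha> x) \<in> cl \<alpha>" "complement (x, \<not> \<alpha> x) \<in> cl \<beta>"
        using that unfolding cl_def falsified_clause_def by auto
      then show False using no by blast
    qed
    \<comment> \<open>Two clauses without a conflict are falsified together by
      \<open>\<gamma>\<close>. Unambiguity then makes them fix the same blocks, so they are
      equal.\<close>
    define \<gamma> where "\<gamma> x = (if x \<in> B \<alpha> then \<alpha> x else \<beta> x)" for x
    have "agree (B \<alpha>) \<alpha> \<gamma>" "agree (B \<beta>) \<beta> \<gamma>"
      using same unfolding agree_def \<gamma>_def by auto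
    then have "B \<alpha> = B \<beta>" using B_eq(2) by metis
    then have "cl \<alpha> = cl \<beta>" using same unfolding cl_def falsified_clause_def by auto
    then show False using that by blast
  qed
  have "\<not> sat_clause \<alpha> (cl \<alpha>)" for \<alpha>
    unfolding cl_def falsified_clause_iff by (simp add: agree_def)
  then have unsat: "unsatisfiable G" unfolding unsatisfiable_def G_def by blast
  have const: "f (majority \<alpha>) = f (majority \<beta>)"
    if C: "C \<in> G" and fals: "\<not> sat_clause \<alpha> C" "\<not> sat_clause \<beta> C" for C \<alpha> \<beta>
  proof -
    obtain \<gamma> where "C = cl \<gamma>" using C unfolding G_def by blast
    then have "agree (B \<gamma>) \<gamma> \<alpha>" "agree (B \<gamma>) \<gamma> \<beta>"
      using fals falsified_clause_iff unfolding cl_def by blast+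
    then show ?thesis using B_eq(1) by metis
  qed
  have "hitting_formula G" unfolding hitting_formula_def using cnf hit unfolding G_def by blast
  moreover have "width C \<le> 3 * w" if "C \<in> G" for C
    using that wd unfolding width_def G_def by blast
  moreover have "2 ^ d \<le> proof_size \<pi>" if "is_refutation G \<pi>" "tree_like \<pi>" for \<pi>
    using tree_like_size_lower_bound[OF that hard const] .
  ultimately show ?thesis using unsat cardG by blast
qed

section \<open>Iteration\<close>


text \<open>The function g in the proof is a disjunction of n copies of f, by De Morgan. T bits name
  \<open>n * c\<close> variables at \<open>2 * t + p\<close> bits each, and the
  \<open>2 ^ \<kappa>\<close> cells are at least as many as the queries that the adversary must
  survive.\<close>

lemma complexity_bounds_step:
  fixes f :: "(nat \<Rightarrow> bool) \<Rightarrow> bool"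
  assumes f: "complexity_bounds f V d (\<lambda>_. c) (\<lambda>b. if b then u else c)"
    and V: "card V < 2 ^ p" and n: "n = 2 ^ t"
    and \<kappa>: "0 < \<kappa>" "n * (n * d) \<le> 2 ^ \<kappa>"
    and T: "T = n * c * (2 * t + p)"
  shows "\<exists>(f' :: (nat \<Rightarrow> bool) \<Rightarrow> bool) V'. complexity_bounds f' V' (n * (n * d)) (\<lambda>_. \<kappa> * (n * c + n * c + T))
      (\<lambda>b. if b then \<kappa> * (n * (n * c + u) + n * c + n * c + T) else \<kappa> * (n * c + n * c + T)) \<and>
    card V' \<le> \<kappa> * (n * (n * card V)) + 2 ^ \<kappa> * (\<kappa> * T)"
proof -
  define g where "g = (\<lambda>\<alpha>. \<not> all_copies n (\<lambda>\<alpha>. \<not> f \<alpha>) \<alpha>)"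
  define V1 where "V1 = {..<n} \<times> ({..<n} \<times> V)"
  have n1: "1 \<le> n" using n by simp
  have finV: "finite V" using f unfolding complexity_bounds_def by blast
  note c1 = complexity_bounds_not[OF complexity_bounds_all_copies[OF complexity_bounds_not[OF f]], of n, folded g_def]
  \<comment> \<open>In the disjunction only the first true copy costs u; the false copies before it
    cost c each.\<close>
  have c1': "complexity_bounds g ({..<n} \<times> V) (n * d) (\<lambda>b. if b then c else n * c)
      (\<lambda>b. if b then n * c + u else n * c)"
    by (rule complexity_bounds_mono[OF c1]) auto
  have "complexity_bounds (all_copies n g) V1 (n * (n * d)) (\<lambda>_. n * c)
      (\<lambda>_. n * (n * c + u) + n * c)"
    unfolding V1_def by (rule complexity_bounds_mono[OF complexity_bounds_all_copies[OF c1']]) auto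
  moreover have "(card V1 + 1) ^ (n * c) \<le> 2 ^ T"
  proof -
    have "card V1 + 1 \<le> n * n * (card V + 1)"
      using n1 by (simp add: V1_def card_cartesian_product)
    also have "\<dots> \<le> n * n * 2 ^ p" using V by (intro mult_le_mono2) simp
    also have "\<dots> = 2 ^ (2 * t + p)" by (simp add: n power_add mult_2)
    finally have "(card V1 + 1) ^ (n * c) \<le> (2 ^ (2 * t + p)) ^ (n * c)" by (rule power_mono) simp
    then show ?thesis by (simp add: T power_mult[symmetric] mult.commute)
  qed
  ultimately obtain dec where cs: "complexity_bounds (cheat_sheet \<kappa> T dec (all_copies n g))
      (Inl ` ({..<\<kappa>} \<times> V1) \<union> Inr ` ({l. length l = \<kappa>} \<times> {..<\<kappa>} \<times> {..<T})) (n * (n * d))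
      (\<lambda>_. \<kappa> * (n * c + n * c + T))
      (\<lambda>b. if b then \<kappa> * (n * c + T) else \<kappa> * (n * (n * c + u) + n * c + n * c + T))"
    using complexity_bounds_cheat_sheet[OF _ _ \<kappa>] by blast
  define W where "W = (Inl ` ({..<\<kappa>} \<times> V1) \<union> Inr ` ({l. length l = \<kappa>} \<times> {..<\<kappa>} \<times> {..<T})
    :: (nat \<times> nat \<times> nat) sheet_var set)"
  \<comment> \<open>The unambiguous bound for false is rounded up to the ordinary certificate bound.
    A single number then plays the role of c in the next round.\<close>
  have "complexity_bounds (\<lambda>\<alpha>. \<not> cheat_sheet \<kappa> T dec (all_copies n g) (\<lambda>x. \<alpha> (to_nat x)))
      (to_nat ` W) (n * (n * d)) (\<lambda>_. \<kappa> * (n * c + n * c + T))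
      (\<lambda>b. if b then \<kappa> * (n * (n * c + u) + n * c + n * c + T) else \<kappa> * (n * c + n * c + T))"
    unfolding W_def
    by (rule complexity_bounds_mono[OF complexity_bounds_transport[OF complexity_bounds_not[OF cs]]])
      auto
  moreover have "card (to_nat ` W) \<le> \<kappa> * (n * (n * card V)) + 2 ^ \<kappa> * (\<kappa> * T)"
  proof -
    have "card (to_nat ` W) = card W" by (intro card_image inj_on_subset[OF inj_to_nat]) auto
    also have "\<dots> \<le> card ({..<\<kappa>} \<times> V1) + card ({l :: bool list. length l = \<kappa>} \<times> {..<\<kappa>} \<times> {..<T})"
      unfolding W_def using finV finite_bool_lists
      by (intro order_trans[OF card_Un_le] add_mono card_image_le) (auto simp: V1_def)
    finally show ?thesis by (simp add: card_cartesian_product V1_def card_bool_lists)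
  qed
  ultimately show ?thesis by blast
qed

section \<open>Factors polynomial in t, that is, polylogarithmic in n\<close>

definition poly_bounded :: "(nat \<Rightarrow> nat) \<Rightarrow> bool" where
  "poly_bounded g \<longleftrightarrow> (\<exists>A. \<forall>t. g t \<le> (A * (t + 1)) ^ A)"

lemma poly_boundedI:
  assumes "poly_bounded h" "\<And>t. g t \<le> h t"
  shows "poly_bounded g"
  using assms order_trans unfolding poly_bounded_def by blast

lemma self_power_mono:
  fixes t :: nat
  assumes "A \<le> B"
  shows "(A * (t + 1)) ^ A \<le> (B * (t + 1)) ^ B"
proof (cases "A = 0")
  case True
  then show ?thesis using assms by (cases "B = 0") (auto simp: Suc_le_eq)
next
  case False
  have "(A * (t + 1)) ^ A \<le> (B * (t + 1)) ^ A" using assms by (intro power_mono mult_le_mono1) auto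
  also have "\<dots> \<le> (B * (t + 1)) ^ B" using assms False by (intro power_increasing) auto
  finally show ?thesis .
qed

lemma poly_bounded_const: "poly_bounded (\<lambda>_. k)"
  unfolding poly_bounded_def
proof (intro exI allI)
  fix t
  have "k \<le> (k + 1) * (t + 1)" by simp
  also have "\<dots> \<le> ((k + 1) * (t + 1)) ^ (k + 1)" by (rule self_le_power) auto
  finally show "k \<le> ((k + 1) * (t + 1)) ^ (k + 1)" .
qed

lemma poly_bounded_id: "poly_bounded (\<lambda>t. t)"
  unfolding poly_bounded_def by (intro exI[of _ 1]) simp

lemma poly_bounded_mult:
  assumes "poly_bounded g" "poly_bounded h"
  shows "poly_bounded (\<lambda>t. g t * h t)"
proof -
  obtain A B where AB: "\<And>t. g t \<le> (A * (t + 1)) ^ A" "\<And>t. h t \<le> (B * (t + 1)) ^ B"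
    using assms unfolding poly_bounded_def by blast
  have "g t * h t \<le> ((A + B) * (t + 1)) ^ (A + B)" for t
  proof -
    have "g t \<le> ((A + B) * (t + 1)) ^ A"
      by (rule order_trans[OF AB(1)]) (intro power_mono mult_le_mono1; simp)
    moreover have "h t \<le> ((A + B) * (t + 1)) ^ B"
      by (rule order_trans[OF AB(2)]) (intro power_mono mult_le_mono1; simp)
    ultimately show ?thesis unfolding power_add by (rule mult_le_mono)
  qed
  then show ?thesis unfolding poly_bounded_def by blast
qed

lemma poly_bounded_add:
  assumes "poly_bounded g" "poly_bounded h"
  shows "poly_bounded (\<lambda>t. g t + h t)"
proof -
  obtain A B where AB: "\<And>t. g t \<le> (A * (t + 1)) ^ A" "\<And>t. h t \<le> (B * (t + 1)) ^ B"
    using assms unfolding poly_bounded_def by blast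
  define D where "D = A + B"
  have "g t + h t \<le> 2 * (D * (t + 1)) ^ D" for t
    using order_trans[OF AB(1) self_power_mono[of A D t]]
      order_trans[OF AB(2) self_power_mono[of B D t]] unfolding D_def by fastforce
  moreover have "poly_bounded (\<lambda>t. 2 * (D * (t + 1)) ^ D)"
    by (intro poly_bounded_mult poly_bounded_const) (auto simp: poly_bounded_def)
  ultimately show ?thesis by (rule poly_boundedI[rotated])
qed

lemmas poly_bounded_intros =
  poly_bounded_const poly_bounded_id poly_bounded_mult poly_bounded_add

lemma poly_bounded_le_exp:
  assumes "poly_bounded g"
  shows "\<exists>B. \<forall>t. g t \<le> B * 2 ^ t"
proof -
  obtain A where A: "\<And>t. g t \<le> (A * (t + 1)) ^ A" using assms unfolding poly_bounded_def by blast
  \<comment> \<open>This choice gives \<open>(1 + x) ^ Suc A = 2\<close>. Bernoulli's inequality and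
    \<open>x \<le> 1\<close> give \<open>x * (t + 1) \<le> (1 + x) ^ t\<close>, and raising this to
    the power \<open>Suc A\<close> turns the right side into \<open>2 ^ t\<close>. The successor
    avoids a zeroth root when A is 0.\<close>
  define x where "x = root (Suc A) 2 - 1"
  have x: "0 < x" "x \<le> 1"
  proof -
    show "0 < x" unfolding x_def by simp
    have "root (Suc A) 2 \<le> root (Suc A) (2 ^ Suc A)"
      using self_le_power[of "2 :: real" "Suc A"] by (simp del: power_Suc)
    then show "x \<le> 1" unfolding x_def by (simp add: real_root_power_cancel del: power_Suc)
  qed
  have "real (t + 1) ^ Suc A \<le> 2 ^ t / x ^ Suc A" for t
  proof -
    have "x * real (t + 1) \<le> 1 + real t * x" using x by (simp add: algebra_simps)
    also have "\<dots> \<le> (1 + x) ^ t" using x by (intro Bernoulli_inequality) simp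
    finally have "(x * real (t + 1)) ^ Suc A \<le> ((1 + x) ^ t) ^ Suc A"
      using x by (intro power_mono) auto
    also have "\<dots> = ((1 + x) ^ Suc A) ^ t" by (metis mult.commute power_mult)
    also have "(1 + x) ^ Suc A = 2" unfolding x_def by (simp add: real_root_pow_pos2 del: power_Suc)
    finally have "x ^ Suc A * real (t + 1) ^ Suc A \<le> 2 ^ t" by (simp only: power_mult_distrib)
    then show ?thesis using x by (simp add: pos_le_divide_eq mult.commute del: power_Suc of_nat_Suc)
  qed
  note key = this
  define B where "B = A ^ A * nat \<lceil>1 / x ^ Suc A\<rceil>"
  have "g t \<le> B * 2 ^ t" for t
  proof -
    have "real ((t + 1) ^ A) \<le> real ((t + 1) ^ Suc A)"
      by (intro of_nat_mono power_increasing) auto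
    also have "\<dots> \<le> 1 / x ^ Suc A * 2 ^ t"
      using key[of t] by (simp only: of_nat_power times_divide_eq_left mult_1)
    also have "\<dots> \<le> real (nat \<lceil>1 / x ^ Suc A\<rceil>) * 2 ^ t"
      by (intro mult_right_mono real_nat_ceiling_ge) auto
    finally have "real ((t + 1) ^ A) \<le> real (nat \<lceil>1 / x ^ Suc A\<rceil> * 2 ^ t)" by simp
    then have "(t + 1) ^ A \<le> nat \<lceil>1 / x ^ Suc A\<rceil> * 2 ^ t" by (simp only: of_nat_le_iff)
    then have "A ^ A * (t + 1) ^ A \<le> A ^ A * (nat \<lceil>1 / x ^ Suc A\<rceil> * 2 ^ t)" by (rule mult_le_mono2)
    then show ?thesis using order_trans[OF A[of t]] unfolding B_def power_mult_distrib
      by (simp only: mult.assoc)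
  qed
  then show ?thesis by blast
qed

text \<open>The factor p may depend on k but not on t, so each round may lose any polynomial in t.
  Of the number of variables only the logarithm matters: it enters the cell length and, later, the
  number of clauses.\<close>

lemma iterated_functions:
  "\<exists>p. poly_bounded p \<and> (\<forall>t. \<exists>(f :: (nat \<Rightarrow> bool) \<Rightarrow> bool) V c u.
     complexity_bounds f V (2 ^ (2 * k * t)) (\<lambda>_. c) (\<lambda>b. if b then u else c) \<and>
     c \<le> p t * 2 ^ (k * t) \<and> u \<le> p t * 2 ^ ((k + 1) * t) \<and> card V < 2 ^ p t)"
proof (induction k)
  case 0
  have "\<exists>(f :: (nat \<Rightarrow> bool) \<Rightarrow> bool) V c u.
     complexity_bounds f V (2 ^ (2 * 0 * t)) (\<lambda>_. c) (\<lambda>b. if b then u else c) \<and>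
     c \<le> 1 * 2 ^ (0 * t) \<and> u \<le> 1 * 2 ^ ((0 + 1) * t) \<and> card V < 2 ^ 1" for t :: nat
    by (rule exI[of _ "\<lambda>\<alpha>. \<alpha> 0"], rule exI[of _ "{0}"], rule exI[of _ 1], rule exI[of _ 1])
      (use complexity_bounds_var[of "0 :: nat"] in simp)
  then show ?case using poly_bounded_const[of 1] by (intro exI[of _ "\<lambda>_. 1"] conjI) blast+
next
  case (Suc k)
  then obtain p where p: "poly_bounded p" and
    IH: "\<And>t. \<exists>(f :: (nat \<Rightarrow> bool) \<Rightarrow> bool) V c u.
     complexity_bounds f V (2 ^ (2 * k * t)) (\<lambda>_. c) (\<lambda>b. if b then u else c) \<and>
     c \<le> p t * 2 ^ (k * t) \<and> u \<le> p t * 2 ^ ((k + 1) * t) \<and> card V < 2 ^ p t"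
    by blast
  \<comment> \<open>The address length: there must be at least as many cells as the new depth
    \<open>2 ^ (2 * Suc k * t)\<close>. The added 1 keeps it positive at t = 0.\<close>
  define K where "K t = 2 * (k + 1) * t + 1" for t
  define Q where "Q t = p t * (2 * t + p t)" for t
  \<comment> \<open>The first summand bounds the new c and u; the second, with some slack, bounds
    the logarithm of the new number of variables.\<close>
  define P where "P t = K t * (5 * p t + Q t) + (2 * K t + 2 * p t + (k + 3) * t + 2 * t + 2)" for t
  have "poly_bounded P"
    unfolding P_def K_def Q_def by (intro poly_bounded_intros p)
  moreover have "\<exists>(f :: (nat \<Rightarrow> bool) \<Rightarrow> bool) V c u.
     complexity_bounds f V (2 ^ (2 * Suc k * t)) (\<lambda>_. c) (\<lambda>b. if b then u else c) \<and>
     c \<le> P t * 2 ^ (Suc k * t) \<and> u \<le> P t * 2 ^ ((Suc k + 1) * t) \<and> card V < 2 ^ P t" for t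
  proof -
    define n where "n = (2 :: nat) ^ t"
    define N where "N = (2 :: nat) ^ (Suc k * t)"
    obtain f :: "(nat \<Rightarrow> bool) \<Rightarrow> bool" and V c u where
      f: "complexity_bounds f V (2 ^ (2 * k * t)) (\<lambda>_. c) (\<lambda>b. if b then u else c)" and
      c: "c \<le> p t * 2 ^ (k * t)" and u: "u \<le> p t * 2 ^ ((k + 1) * t)" and V: "card V < 2 ^ p t"
      using IH[of t] by blast
    define T where "T = n * c * (2 * t + p t)"
    have d: "n * (n * 2 ^ (2 * k * t)) = 2 ^ (2 * Suc k * t)"
      unfolding n_def by (simp add: power_add[symmetric] algebra_simps)
    have nN: "n * 2 ^ (k * t) = N" "2 ^ ((Suc k + 1) * t) = n * N"
      unfolding n_def N_def by (simp_all add: power_add[symmetric] algebra_simps)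
    have d': "n * (n * 2 ^ (2 * k * t)) \<le> 2 ^ K t"
      unfolding d by (rule power_increasing) (simp_all add: K_def)
    obtain f' :: "(nat \<Rightarrow> bool) \<Rightarrow> bool" and V' where
      f': "complexity_bounds f' V' (n * (n * 2 ^ (2 * k * t))) (\<lambda>_. K t * (n * c + n * c + T))
        (\<lambda>b. if b then K t * (n * (n * c + u) + n * c + n * c + T) else K t * (n * c + n * c + T))" and
      V': "card V' \<le> K t * (n * (n * card V)) + 2 ^ K t * (K t * T)"
      using complexity_bounds_step[OF f V n_def _ d' T_def] unfolding K_def by auto
    have nc: "n * c \<le> p t * N"
      using mult_le_mono2[OF c, of n] by (simp add: nN(1)[symmetric] mult_ac)
    have nu: "u \<le> p t * N" using u unfolding N_def by simp
    have T: "T \<le> Q t * N"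
      unfolding T_def Q_def using mult_le_mono1[OF nc, of "2 * t + p t"] by (simp add: mult_ac)
    have n1: "1 \<le> n" unfolding n_def by simp
    have "n * c + n * c + T \<le> (5 * p t + Q t) * N"
      using nc T by (simp add: algebra_simps)
    then have "K t * (n * c + n * c + T) \<le> K t * ((5 * p t + Q t) * N)" by (rule mult_le_mono2)
    also have "\<dots> \<le> P t * N" unfolding P_def by (simp add: algebra_simps)
    finally have c': "K t * (n * c + n * c + T) \<le> P t * 2 ^ (Suc k * t)" unfolding N_def .
    have le: "x \<le> n * x" for x using mult_le_mono1[OF n1, of x] by simp
    have "n * (n * c + u) \<le> n * (2 * p t * N)" using nc nu by (intro mult_le_mono2) simp
    moreover have "n * c \<le> n * (p t * N)" "T \<le> n * (Q t * N)"
      using order_trans[OF nc le] order_trans[OF T le] .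
    ultimately have "n * (n * c + u) + n * c + n * c + T \<le>
        n * (2 * p t * N) + n * (p t * N) + n * (p t * N) + n * (Q t * N)"
      by (intro add_mono)
    also have "\<dots> \<le> (5 * p t + Q t) * (n * N)" by (simp add: algebra_simps)
    finally have "n * (n * c + u) + n * c + n * c + T \<le> (5 * p t + Q t) * (n * N)" .
    then have "K t * (n * (n * c + u) + n * c + n * c + T) \<le> K t * ((5 * p t + Q t) * (n * N))"
      by (rule mult_le_mono2)
    also have "\<dots> \<le> P t * (n * N)" unfolding P_def by (simp add: algebra_simps)
    finally have u': "K t * (n * (n * c + u) + n * c + n * c + T) \<le> P t * 2 ^ ((Suc k + 1) * t)"
      unfolding nN(2) .
    have V'': "card V' < 2 ^ P t"
    proof -
      let ?e = "2 * K t + 2 * p t + (k + 3) * t + 2 * t"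
      have pow: "x \<le> 2 ^ x" for x :: nat using less_exp[of x] by simp
      have "K t * (n * (n * card V)) \<le> 2 ^ K t * (2 ^ t * (2 ^ t * 2 ^ p t))"
        unfolding n_def using V pow by (intro mult_le_mono) auto
      also have "\<dots> = 2 ^ (K t + (t + (t + p t)))" by (simp add: power_add)
      also have "\<dots> \<le> 2 ^ ?e" by (rule power_increasing) (auto simp: algebra_simps)
      finally have 1: "K t * (n * (n * card V)) \<le> 2 ^ ?e" .
      have "2 ^ K t * (K t * T) \<le> 2 ^ K t * (2 ^ K t * ((2 ^ p t * 2 ^ (2 * t + p t)) * 2 ^ (Suc k * t)))"
        using T pow unfolding Q_def N_def
        by (intro mult_le_mono order_refl order_trans[OF T[unfolded Q_def N_def]]) auto
      also have "\<dots> = 2 ^ (K t + (K t + ((p t + (2 * t + p t)) + Suc k * t)))"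
        by (simp only: power_add)
      also have "\<dots> \<le> 2 ^ ?e" by (rule power_increasing) (auto simp: algebra_simps)
      finally have "card V' \<le> 2 ^ ?e + 2 ^ ?e" using V' 1 by linarith
      also have "\<dots> < 2 ^ (?e + 2)" by simp
      also have "\<dots> \<le> 2 ^ P t" unfolding P_def by (rule power_increasing) auto
      finally show ?thesis .
    qed
    show ?thesis using f'[unfolded d] c' u' V'' by blast
  qed
  ultimately show ?case by blast
qed

section \<open>Choice of parameters and asymptotics\<close>

lemma hard_hitting_formulas:
  "\<exists>B. \<forall>t. \<exists>G. hitting_formula G \<and> unsatisfiable G \<and>
     (\<forall>C\<in>G. width C \<le> B * 2 ^ ((k + 2) * t)) \<and> card G \<le> 2 ^ (B * 2 ^ ((k + 2) * t)) \<and>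
     (\<forall>\<pi>. is_refutation G \<pi> \<and> tree_like \<pi> \<longrightarrow> 2 ^ 2 ^ (2 * k * t) \<le> proof_size \<pi>)"
proof -
  obtain p where p: "poly_bounded p" and
    fn: "\<And>t. \<exists>(f :: (nat \<Rightarrow> bool) \<Rightarrow> bool) V c u.
     complexity_bounds f V (2 ^ (2 * k * t)) (\<lambda>_. c) (\<lambda>b. if b then u else c) \<and>
     c \<le> p t * 2 ^ (k * t) \<and> u \<le> p t * 2 ^ ((k + 1) * t) \<and> card V < 2 ^ p t"
    using iterated_functions[of k] by blast
  \<comment> \<open>Here \<open>p t + 3\<close> bounds the logarithm of
    \<open>6 * card V + 1\<close>, and \<open>3 * p t\<close> is the polynomial part of the width.
    One extra factor \<open>2 ^ t\<close> absorbs their product, which is why the exponent grows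
    from k + 1 to k + 2.\<close>
  have "poly_bounded (\<lambda>t. (p t + 3) * (3 * p t))" by (intro poly_bounded_intros p)
  then obtain B where B: "\<And>t. (p t + 3) * (3 * p t) \<le> B * 2 ^ t" using poly_bounded_le_exp by blast
  have "\<exists>G. hitting_formula G \<and> unsatisfiable G \<and>
     (\<forall>C\<in>G. width C \<le> B * 2 ^ ((k + 2) * t)) \<and> card G \<le> 2 ^ (B * 2 ^ ((k + 2) * t)) \<and>
     (\<forall>\<pi>. is_refutation G \<pi> \<and> tree_like \<pi> \<longrightarrow> 2 ^ 2 ^ (2 * k * t) \<le> proof_size \<pi>)" for t
  proof -
    obtain f :: "(nat \<Rightarrow> bool) \<Rightarrow> bool" and V c u where
      f: "complexity_bounds f V (2 ^ (2 * k * t)) (\<lambda>_. c) (\<lambda>b. if b then u else c)" and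
      c: "c \<le> p t * 2 ^ (k * t)" and u: "u \<le> p t * 2 ^ ((k + 1) * t)" and V: "card V < 2 ^ p t"
      using fn[of t] by blast
    define w where "w = p t * 2 ^ ((k + 1) * t)"
    have "c \<le> w" using order_trans[OF c] unfolding w_def by simp
    then have "(if b then u else c) \<le> w" for b using u unfolding w_def by simp
    then obtain G where G: "hitting_formula G" "unsatisfiable G" "\<And>C. C \<in> G \<Longrightarrow> width C \<le> 3 * w"
      "card G \<le> (6 * card V + 1) ^ (3 * w)"
      "\<And>\<pi>. is_refutation G \<pi> \<Longrightarrow> tree_like \<pi> \<Longrightarrow> 2 ^ 2 ^ (2 * k * t) \<le> proof_size \<pi>"
      using lifted_formula_exists[OF f, of w] by blast
    have e: "(p t + 3) * (3 * w) \<le> B * 2 ^ ((k + 2) * t)"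
      using mult_le_mono1[OF B[of t], of "2 ^ ((k + 1) * t)"]
      by (simp add: w_def power_add algebra_simps)
    have "card G \<le> (2 ^ (p t + 3)) ^ (3 * w)"
      using V by (intro order_trans[OF G(4)] power_mono) (auto simp: power_add)
    also have "\<dots> = 2 ^ ((p t + 3) * (3 * w))" by (simp only: power_mult)
    also have "\<dots> \<le> 2 ^ (B * 2 ^ ((k + 2) * t))" using e by (rule power_increasing) simp
    finally have "card G \<le> 2 ^ (B * 2 ^ ((k + 2) * t))" .
    moreover have "3 * w \<le> (p t + 3) * (3 * w)" by simp
    then have "width C \<le> B * 2 ^ ((k + 2) * t)" if "C \<in> G" for C
      using G(3)[OF that] e by linarith
    ultimately show ?thesis using G(1,2,5) by blast
  qed
  then show ?thesis by blast
qed

theorem theorem3p23: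
  fixes \<epsilon> :: real
  assumes "\<epsilon> > 0"
  shows "\<exists>G :: nat \<Rightarrow> cnf.
    (\<forall>m. hitting_formula (G m) \<and> unsatisfiable (G m)) \<and>
    (\<exists>a\<in>soft_O (\<lambda>m. real m). \<forall>m. real (card (G m)) \<le> 2 powr a m) \<and>
    (\<exists>w\<in>soft_O (\<lambda>m. real m). \<forall>m. \<forall>C\<in>G m. real (width C) \<le> w m) \<and>
    (\<exists>h\<in>soft_Omega (\<lambda>m. real m powr (2 - \<epsilon>)). \<forall>m \<pi>.
       is_refutation (G m) \<pi> \<and> tree_like \<pi> \<longrightarrow> real (proof_size \<pi>) \<ge> 2 powr h m)"
proof -
  \<comment> \<open>The exponent reached is 2k/(k+2) = 2 - 4/(k+2), so \<epsilon> (k + 2) \<ge> 4 is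
    needed, and k \<ge> 4/\<epsilon> suffices.\<close>
  define k where "k = nat \<lceil>4 / \<epsilon>\<rceil>"
  have "4 / \<epsilon> \<le> real k" unfolding k_def by (rule real_nat_ceiling_ge)
  then have "4 \<le> \<epsilon> * (real k + 2)" using assms by (simp add: field_simps)
  then have k: "(2 - \<epsilon>) * (real k + 2) \<le> 2 * real k" by (simp add: algebra_simps)
  obtain B G where G: "\<And>t. hitting_formula (G t)" "\<And>t. unsatisfiable (G t)"
     "\<And>t C. C \<in> G t \<Longrightarrow> width C \<le> B * 2 ^ ((k + 2) * t)"
     "\<And>t. card (G t) \<le> 2 ^ (B * 2 ^ ((k + 2) * t))"
     "\<And>t \<pi>. is_refutation (G t) \<pi> \<Longrightarrow> tree_like \<pi> \<Longrightarrow> 2 ^ 2 ^ (2 * k * t) \<le> proof_size \<pi>"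
    using hard_hitting_formulas[of k] by metis
  \<comment> \<open>Only powers of \<open>2 ^ (k + 2)\<close> are natural sizes; any other m uses
    the formula of the largest such power below it. At m = 0 the choice of t is arbitrary: the
    bounds required of every m are stated through \<open>s m\<close>, and only the asymptotic
    comparison needs m positive.\<close>
  have "\<exists>t. 1 \<le> m \<longrightarrow> 2 ^ ((k + 2) * t) \<le> m \<and> m < 2 ^ ((k + 2) * (t + 1))" for m :: nat
  proof (cases "1 \<le> m")
    case True
    have "2 \<le> (2 :: nat) ^ (k + 2)" using self_le_power[of "2 :: nat" "k + 2"] by simp
    then show ?thesis using ex_power_ivl1[of "2 ^ (k + 2)" m] True by (simp only: power_mult) blast
  qed simp
  then obtain s where s: "\<And>m :: nat. 1 \<le> m \<Longrightarrow> 2 ^ ((k + 2) * s m) \<le> m"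
    "\<And>m. 1 \<le> m \<Longrightarrow> m < 2 ^ ((k + 2) * (s m + 1))" by metis
  define a where "a m = real (B * 2 ^ ((k + 2) * s m))" for m
  define h where "h m = real (2 ^ (2 * k * s m))" for m
  \<comment> \<open>The exponent 0 of the logarithm suffices here and for h, since the
    polylogarithmic factors are already absorbed in the loss of \<epsilon>.\<close>
  have "a \<in> O(\<lambda>m. real m * log 2 (real m) ^ 0)"
  proof (rule bigoI[of _ "real B"])
    have "a m \<le> real B * real m" if "1 \<le> m" for m
    proof -
      have "B * 2 ^ ((k + 2) * s m) \<le> B * m" using s(1)[OF that] by (rule mult_le_mono2)
      then show ?thesis unfolding a_def by (metis of_nat_le_iff of_nat_mult)
    qed
    then show "\<forall>\<^sub>F m in at_top. norm (a m) \<le> real B * norm (real m * log 2 (real m) ^ 0)"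
      by (intro eventually_at_top_linorderI[of 1]) (simp add: a_def)
  qed
  then have a: "a \<in> soft_O (\<lambda>m. real m)" unfolding soft_O_def by blast
  have "h \<in> \<Omega>(\<lambda>m. real m powr (2 - \<epsilon>) / log 2 (real m powr (2 - \<epsilon>)) ^ 0)"
  \<comment> \<open>The constant pays for rounding m down: it lies below the next power, whose depth
    is \<open>2 ^ (2 * k)\<close> times larger.\<close>
  proof (rule landau_omega.bigI[of "1 / 2 ^ (2 * k)"])
    have "real m powr (2 - \<epsilon>) \<le> 2 ^ (2 * k) * h m" if m: "1 \<le> m" for m
    proof -
      have "real m powr (2 - \<epsilon>) \<le> real m powr (2 * real k / (real k + 2))"
        using m k by (intro powr_mono) (auto simp: field_simps)
      also have "real m \<le> 2 ^ ((k + 2) * (s m + 1))"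
        using s(2)[OF m] by (metis less_imp_le of_nat_le_iff of_nat_numeral of_nat_power)
      then have "real m powr (2 * real k / (real k + 2)) \<le>
          (2 ^ ((k + 2) * (s m + 1))) powr (2 * real k / (real k + 2))"
        using m by (intro powr_mono2) auto
      also have "\<dots> = 2 powr (real ((k + 2) * (s m + 1)) * (2 * real k / (real k + 2)))"
        by (simp only: powr_realpow[symmetric] powr_powr zero_less_numeral)
      also have "real ((k + 2) * (s m + 1)) * (2 * real k / (real k + 2)) = real (2 * k * (s m + 1))"
        by (simp add: field_simps)
      also have "2 powr real (2 * k * (s m + 1)) = 2 ^ (2 * k) * h m"
        by (simp only: powr_realpow zero_less_numeral) (simp add: h_def power_add algebra_simps)
      finally show ?thesis .
    qed
    then show "\<forall>\<^sub>F m in at_top. norm (h m) \<ge> 1 / 2 ^ (2 * k) *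
        norm (real m powr (2 - \<epsilon>) / log 2 (real m powr (2 - \<epsilon>)) ^ 0)"
      by (intro eventually_at_top_linorderI[of 1]) (simp add: h_def field_simps)
  qed simp
  then have h: "h \<in> soft_Omega (\<lambda>m. real m powr (2 - \<epsilon>))"
    unfolding soft_Omega_def mem_Collect_eq by (intro conjI allI exI[of _ 0]) (simp_all add: h_def)
  have card: "real (card (G (s m))) \<le> 2 powr a m" for m
  proof -
    have "real (card (G (s m))) \<le> real (2 ^ (B * 2 ^ ((k + 2) * s m)))"
      using G(4) by (rule of_nat_mono)
    then show ?thesis unfolding a_def by (simp only: powr_realpow zero_less_numeral) simp
  qed
  have width: "real (width C) \<le> a m" if "C \<in> G (s m)" for m C
    unfolding a_def using G(3)[OF that] by (rule of_nat_mono)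
  have size: "2 powr h m \<le> real (proof_size \<pi>)"
    if "is_refutation (G (s m)) \<pi>" "tree_like \<pi>" for m \<pi>
  proof -
    have "real (2 ^ 2 ^ (2 * k * s m)) \<le> real (proof_size \<pi>)" using G(5)[OF that] by (rule of_nat_mono)
    then show ?thesis unfolding h_def by (simp only: powr_realpow zero_less_numeral) simp
  qed
  show ?thesis
  proof (intro exI[of _ "\<lambda>m. G (s m)"] conjI)
    show "\<forall>m. hitting_formula (G (s m)) \<and> unsatisfiable (G (s m))" using G(1,2) by simp
    show "\<exists>a\<in>soft_O (\<lambda>m. real m). \<forall>m. real (card (G (s m))) \<le> 2 powr a m"
      using card by (intro bexI[OF _ a]) simp
    show "\<exists>w\<in>soft_O (\<lambda>m. real m). \<forall>m. \<forall>C\<in>G (s m). real (width C) \<le> w m"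
      using width by (intro bexI[OF _ a]) simp
    show "\<exists>h\<in>soft_Omega (\<lambda>m. real m powr (2 - \<epsilon>)). \<forall>m \<pi>.
        is_refutation (G (s m)) \<pi> \<and> tree_like \<pi> \<longrightarrow> real (proof_size \<pi>) \<ge> 2 powr h m"
      using size by (intro bexI[OF _ h]) simp
  qed
qed

end
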